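(* Let $K$ be a field with $\operatorname{char}K\neq 2$. A $K$-basis of the Lie superalgebra $\mathbf R=\operatorname{Lie}(v_0,v_1)$ is given by the following two families of operators (called standard monomials of the first and of the second type): (i) $\{r_{n-2}v_n\mid n\ge 0\}$; (ii) $\{r_{n-3}x_{n-1}v_n\mid n\ge 2\}\setminus\{x_0x_2v_3\}$. Here $r_m$ runs over all tail monomials $r_m=x_0^{\xi_0}\cdots x_m^{\xi_m}$, $\xi_i\in\{0,1\}$ (with $r_m=1$ for $m<0$).
   Context: Let $\Lambda=\Lambda(x_i\mid i\ge 0)$ be the Grassmann (exterior) algebra over $K$ on odd generators $x_0,x_1,\dots$ ($x_ix_j=-x_jx_i$, $x_i^2=0$), a $\mathbb Z_2$-graded algebra; $\operatorname{End}\Lambda$ is then an associative superalgebra. Identify $x_i$ with the operator of left multiplication by $x_i$, and let $\partial_i$ be the odd superderivation of $\Lambda$ with $\partial_i(x_j)=\delta_{ij}$ (so $\partial_i(ab)=\partial_i(a)b+(-1)^{\deg a}a\,\partial_i(b)$). The supercommutator is $[a,b]=ab-(-1)^{\deg a\deg b}ba$. The pivot elements are the odd superderivations $$v_i=\partial_i+x_ix_{i+1}(\partial_{i+2}+x_{i+2}x_{i+3}(\partial_{i+4}+x_{i+4}x_{i+5}(\partial_{i+6}+\cdots))),\quad i\ge 0$$ (well defined on $\Lambda$, since each element of $\Lambda$ involves finitely many letters); thus $v_i=\partial_i+x_ix_{i+1}v_{i+2}$. $\mathbf R=\operatorname{Lie}(v_0,v_1)$ is the Lie superalgebra generated by $v_0,v_1$: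 the smallest subspace of $\operatorname{End}\Lambda$ containing $v_0,v_1$ and closed under the supercommutator. Products such as $r_{n-2}v_n$ are compositions of operators. *)

theory Defs
  imports Complex_Main
begin

section \<open>The Grassmann algebra on countably many generators\<close>

text \<open>
  An element of \<open>\<Lambda> = \<Lambda>(x\<^sub>i | i \<ge> 0)\<close> is its coordinate function with respect to the monomial
  basis: the coefficient at a finite set \<open>A = {i\<^sub>1 < \<dots> < i\<^sub>k}\<close> is that of \<open>x\<^bsub>i\<^sub>1\<^esub> \<cdots> x\<^bsub>i\<^sub>k\<^esub>\<close>.
\<close>

typedef (overloaded) 'k grassmann =
  "{f :: nat set \<Rightarrow> 'k::field. finite {A. f A \<noteq> 0} \<and> (\<forall>A. f A \<noteq> 0 \<longrightarrow> finite A)}"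
  morphisms coeff Abs_grassmann
  by (rule exI[of _ "\<lambda>_. 0"]) simp

setup_lifting type_definition_grassmann

lemma finite_support [simp]: "finite {A. coeff a A \<noteq> 0}"
  using coeff[of a] by simp

lemma coeff_infinite [simp]: "infinite A \<Longrightarrow> coeff a A = 0"
  using coeff[of a] by blast

lemma coeff_nonzero_finite: "coeff a A \<noteq> 0 \<Longrightarrow> finite A"
  using coeff_infinite by blast

lemma grassmann_eqI:
  assumes "\<And>A. finite A \<Longrightarrow> coeff a A = coeff b A"
  shows "a = b"
  using assms by (metis coeff_infinite coeff_inject ext)

text \<open>
  Sorting the concatenation of the increasing monomials at \<open>A\<close> and at \<open>B\<close> (disjoint) needs one
  transposition for each inversion.
\<close>

definition inv_sign :: "nat set \<Rightarrow> nat set \<Rightarrow> 'k::field" where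
  "inv_sign A B = (-1) ^ card {(i, j). i \<in> A \<and> j \<in> B \<and> j < i}"

lemma finite_inversions:
  "finite A \<Longrightarrow> finite B \<Longrightarrow> finite {(i, j). i \<in> A \<and> j \<in> B \<and> j < (i::nat)}"
  by (rule finite_subset[of _ "A \<times> B"]) auto

lemma inv_sign_Un_left:
  assumes "finite A" "finite B" "finite C" "A \<inter> B = {}"
  shows "inv_sign (A \<union> B) C = inv_sign A C * inv_sign B C"
proof -
  have "{(i, j). i \<in> A \<union> B \<and> j \<in> C \<and> j < i}
      = {(i, j). i \<in> A \<and> j \<in> C \<and> j < i} \<union> {(i, j). i \<in> B \<and> j \<in> C \<and> j < i}"
    by auto
  moreover have "{(i, j). i \<in> A \<and> j \<in> C \<and> j < i} \<inter> {(i, j). i \<in> B \<and> j \<in> C \<and> j < i} = {}"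
    using assms by auto
  ultimately show ?thesis
    unfolding inv_sign_def using assms
    by (simp add: card_Un_disjoint finite_inversions power_add)
qed

lemma inv_sign_Un_right:
  assumes "finite A" "finite B" "finite C" "A \<inter> B = {}"
  shows "inv_sign C (A \<union> B) = inv_sign C A * inv_sign C B"
proof -
  have "{(i, j). i \<in> C \<and> j \<in> A \<union> B \<and> j < i}
      = {(i, j). i \<in> C \<and> j \<in> A \<and> j < i} \<union> {(i, j). i \<in> C \<and> j \<in> B \<and> j < i}"
    by auto
  moreover have "{(i, j). i \<in> C \<and> j \<in> A \<and> j < i} \<inter> {(i, j). i \<in> C \<and> j \<in> B \<and> j < i} = {}"
    using assms by auto
  ultimately show ?thesis
    unfolding inv_sign_def using assms
    by (simp add: card_Un_disjoint finite_inversions power_add)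
qed

lemma inv_sign_empty [simp]: "inv_sign {} A = 1" "inv_sign A {} = 1"
  by (simp_all add: inv_sign_def)

lemma inv_sign_single_left: "inv_sign {i} B = (-1) ^ card {j \<in> B. j < i}"
proof -
  have "{(i', j). i' \<in> {i} \<and> j \<in> B \<and> j < i'} = Pair i ` {j \<in> B. j < i}" by auto
  then show ?thesis unfolding inv_sign_def by (simp add: card_image inj_on_def)
qed

lemma inv_sign_single_right: "inv_sign A {i} = (-1) ^ card {j \<in> A. i < j}"
proof -
  have "{(i', j). i' \<in> A \<and> j \<in> {i} \<and> j < i'} = (\<lambda>j. (j, i)) ` {j \<in> A. i < j}" by auto
  then show ?thesis unfolding inv_sign_def by (simp add: card_image inj_on_def)
qed

instantiation grassmann :: (field) ring_1
begin

lift_definition zero_grassmann :: "'a grassmann" is "\<lambda>_. 0" by simp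

lift_definition one_grassmann :: "'a grassmann" is "\<lambda>A. if A = {} then 1 else 0"
  by auto

lift_definition plus_grassmann :: "'a grassmann \<Rightarrow> 'a grassmann \<Rightarrow> 'a grassmann"
  is "\<lambda>a b A. a A + b A"
proof goal_cases
  case (1 a b)
  have "{A. a A + b A \<noteq> 0} \<subseteq> {A. a A \<noteq> 0} \<union> {A. b A \<noteq> 0}" by auto
  with 1 show ?case by (auto intro: finite_subset)
qed

lift_definition uminus_grassmann :: "'a grassmann \<Rightarrow> 'a grassmann" is "\<lambda>a A. - a A"
  by simp

lift_definition minus_grassmann :: "'a grassmann \<Rightarrow> 'a grassmann \<Rightarrow> 'a grassmann"
  is "\<lambda>a b A. a A - b A"
proof goal_cases
  case (1 a b)
  have "{A. a A - b A \<noteq> 0} \<subseteq> {A. a A \<noteq> 0} \<union> {A. b A \<noteq> 0}" by auto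
  with 1 show ?case by (auto intro: finite_subset)
qed

lift_definition times_grassmann :: "'a grassmann \<Rightarrow> 'a grassmann \<Rightarrow> 'a grassmann"
  is "\<lambda>a b C. \<Sum>A\<in>Pow C. inv_sign A (C - A) * a A * b (C - A)"
proof goal_cases
  case (1 a b)
  let ?f = "\<lambda>C. \<Sum>A\<in>Pow C. inv_sign A (C - A) * a A * b (C - A)"
  have ex: "\<exists>A\<in>Pow C. a A \<noteq> 0 \<and> b (C - A) \<noteq> 0" if "?f C \<noteq> 0" for C
    using that by (metis (no_types, lifting) mult_zero_left mult_zero_right sum.neutral)
  have "{C. ?f C \<noteq> 0} \<subseteq> (\<lambda>(A, B). A \<union> B) ` ({A. a A \<noteq> 0} \<times> {B. b B \<noteq> 0})"
  proof
    fix C assume "C \<in> {C. ?f C \<noteq> 0}"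
    with ex obtain A where "A \<subseteq> C" "a A \<noteq> 0" "b (C - A) \<noteq> 0" by blast
    then show "C \<in> (\<lambda>(A, B). A \<union> B) ` ({A. a A \<noteq> 0} \<times> {B. b B \<noteq> 0})"
      by (intro image_eqI[of _ _ "(A, C - A)"]) auto
  qed
  moreover have "finite ({A. a A \<noteq> 0} \<times> {B. b B \<noteq> 0})" using 1 by simp
  ultimately have "finite {C. ?f C \<noteq> 0}" by (rule finite_surj[rotated])
  moreover have "finite C" if "?f C \<noteq> 0" for C
    using that by (cases "finite C") auto
  ultimately show ?case by blast
qed

instance
proof
  fix a b c :: "'a grassmann"
  show "a + b + c = a + (b + c)" by transfer (simp add: add.assoc)
  show "a + b = b + a" by transfer (simp add: add.commute)
  show "0 + a = a" by transfer simp
  show "- a + a = 0" by transfer simp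
  show "a - b = a + - b" by transfer simp
  show "(a + b) * c = a * c + b * c" by transfer (simp add: algebra_simps sum.distrib)
  show "a * (b + c) = a * b + a * c" by transfer (simp add: algebra_simps sum.distrib)
  show "(0 :: 'a grassmann) \<noteq> 1" by transfer (auto dest: fun_cong[of _ _ "{}"])
  show "1 * a = a"
  proof (rule grassmann_eqI)
    fix C :: "nat set" assume "finite C"
    have "coeff (1 * a) C
        = (\<Sum>A\<in>Pow C. if A = {} then coeff a C else 0)"
      unfolding times_grassmann.rep_eq one_grassmann.rep_eq
      by (intro sum.cong) auto
    then show "coeff (1 * a) C = coeff a C" using \<open>finite C\<close> by simp
  qed
  show "a * 1 = a"
  proof (rule grassmann_eqI)
    fix C :: "nat set" assume "finite C"
    have "coeff (a * 1) C
        = (\<Sum>A\<in>Pow C. if A = C then coeff a C else 0)"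
      unfolding times_grassmann.rep_eq one_grassmann.rep_eq
      by (intro sum.cong) auto
    then show "coeff (a * 1) C = coeff a C" using \<open>finite C\<close> by simp
  qed
  show "a * b * c = a * (b * c)"
  proof (rule grassmann_eqI)
    fix C :: "nat set" assume fin: "finite C"
    let ?S = "Sigma (Pow C) (\<lambda>D. Pow D)"
    let ?T = "Sigma (Pow C) (\<lambda>A. Pow (C - A))"
    let ?f = "\<lambda>(D, A). inv_sign D (C - D) * (inv_sign A (D - A) * coeff a A * coeff b (D - A))
        * coeff c (C - D)"
    let ?g = "\<lambda>(A, B). inv_sign A (C - A) * coeff a A
        * (inv_sign B (C - A - B) * coeff b B * coeff c (C - A - B))"
    have "coeff (a * b * c) C = sum ?f ?S"
      unfolding times_grassmann.rep_eq sum_distrib_left sum_distrib_right using fin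
      by (subst sum.Sigma) (auto intro: finite_subset)
    also have "\<dots> = sum ?g ?T"
    proof (rule sum.reindex_bij_witness[where j = "\<lambda>(D, A). (A, D - A)" and i = "\<lambda>(A, B). (A \<union> B, A)"])
      fix p assume "p \<in> ?S"
      then obtain D A where p: "p = (D, A)" "A \<subseteq> D" "D \<subseteq> C" by blast
      let ?B = "D - A" and ?E = "C - D"
      have fins: "finite A" "finite ?B" "finite ?E" using p fin by (auto intro: finite_subset)
      have D: "D = A \<union> ?B" and CA: "C - A = ?B \<union> ?E" and E: "C - A - ?B = ?E" using p by auto
      have "(inv_sign D ?E :: 'a) = inv_sign A ?E * inv_sign ?B ?E"
        using fins by (subst D, subst inv_sign_Un_left) auto
      moreover have "(inv_sign A (C - A) :: 'a) = inv_sign A ?B * inv_sign A ?E"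
        using fins p by (subst CA, subst inv_sign_Un_right) auto
      ultimately show "?g (case p of (D, A) \<Rightarrow> (A, D - A)) = ?f p"
        using p by (simp add: E)
    qed auto
    also have "\<dots> = coeff (a * (b * c)) C"
      unfolding times_grassmann.rep_eq sum_distrib_left sum_distrib_right using fin
      by (subst sum.Sigma) (auto intro: finite_subset)
    finally show "coeff (a * b * c) C = coeff (a * (b * c)) C" .
  qed
qed

end

lift_definition gscale :: "'k::field \<Rightarrow> 'k grassmann \<Rightarrow> 'k grassmann" is "\<lambda>c a A. c * a A"
  by (auto elim: rev_finite_subset)

interpretation Grassmann: vector_space gscale
  by unfold_locales (transfer; simp add: algebra_simps fun_eq_iff)+

lemma gscale_mult_left: "gscale c a * b = gscale c (a * b)"
  by transfer (simp add: sum_distrib_left algebra_simps)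

lemma gscale_mult_right: "a * gscale c b = gscale c (a * b)"
  by transfer (simp add: sum_distrib_left algebra_simps)

lift_definition gmono :: "nat set \<Rightarrow> 'k::field grassmann"
  is "\<lambda>A B. if finite A \<and> B = A then 1 else 0"
  by auto

definition gen :: "nat \<Rightarrow> 'k::field grassmann" where
  "gen i = gmono {i}"

lemma coeff_add [simp]: "coeff (a + b) A = coeff a A + coeff b A"
  by transfer simp

lemma coeff_minus [simp]: "coeff (- a) A = - coeff a A"
  by transfer simp

lemma coeff_diff [simp]: "coeff (a - b) A = coeff a A - coeff b A"
  by transfer simp

lemma coeff_zero [simp]: "coeff 0 A = 0"
  by transfer simp

lemma coeff_gscale [simp]: "coeff (gscale c a) A = c * coeff a A"
  by transfer simp

lemma coeff_sum: "coeff (sum f I) A = (\<Sum>i\<in>I. coeff (f i) A)"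
  by (induction I rule: infinite_finite_induct) auto

lemma gmono_mult:
  assumes "finite A" "finite B"
  shows "(gmono A * gmono B :: 'k::field grassmann)
    = (if A \<inter> B = {} then gscale (inv_sign A B) (gmono (A \<union> B)) else 0)"
proof (rule grassmann_eqI)
  fix C :: "nat set" assume fin: "finite C"
  have "coeff (gmono A * gmono B :: 'k grassmann) C
      = (\<Sum>A'\<in>Pow C. if A' = A then (if C - A = B then inv_sign A B else 0) else 0)"
    unfolding times_grassmann.rep_eq gmono.rep_eq by (intro sum.cong) (use assms in auto)
  also have "\<dots> = (if A \<subseteq> C \<and> C - A = B then inv_sign A B else 0)"
    using fin by (simp add: sum.delta)
  also have "\<dots> = coeff (if A \<inter> B = {} then gscale (inv_sign A B) (gmono (A \<union> B)) else 0 :: 'k grassmann) C"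
  proof -
    have "A \<subseteq> C \<and> C - A = B \<longleftrightarrow> A \<inter> B = {} \<and> C = A \<union> B" by blast
    then show ?thesis using assms by (auto simp: gmono.rep_eq)
  qed
  finally show "coeff (gmono A * gmono B :: 'k grassmann) C
    = coeff (if A \<inter> B = {} then gscale (inv_sign A B) (gmono (A \<union> B)) else 0) C" .
qed

lemma gmono_empty [simp]: "gmono {} = 1"
  by transfer auto

lemma gen_square [simp]: "gen i * gen i = 0"
  by (simp add: gen_def gmono_mult)

lemma gen_anticommute: "gen i * gen j = - (gen j * gen i)"
proof -
  have "{k. k = p \<and> k < q} = (if p < q then {p} else {})" for p q :: nat by auto
  then show ?thesis
    by (cases i j rule: linorder_cases)
      (simp_all add: gen_def gmono_mult inv_sign_single_left insert_commute)
qed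

lemma gmono_insert_least:
  assumes "finite A" "\<And>j. j \<in> A \<Longrightarrow> i < j"
  shows "gmono (insert i A) = gen i * gmono A"
proof -
  have e: "card {j \<in> A. j < i} = 0" and "i \<notin> A" using assms(2) by (auto dest: order_less_asym)
  then show ?thesis
    using assms(1) by (simp add: gen_def gmono_mult inv_sign_single_left e del: card_0_eq card_eq_0_iff)
qed

lemma gmono_eq_prod_list:
  assumes "finite A"
  shows "(gmono A :: 'k::field grassmann) = prod_list (map gen (sorted_list_of_set A))"
  using assms
proof (induction "card A" arbitrary: A)
  case 0 then show ?case by simp
next
  case (Suc n)
  then have ne: "A \<noteq> {}" by auto
  let ?i = "Min A" and ?B = "A - {Min A}"
  have A: "A = insert ?i ?B" using Min_in[OF Suc.prems ne] by blast
  have less: "?i < j" if "j \<in> ?B" for j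
    using that Suc.prems by (metis Diff_iff Min_le insertI1 order_le_imp_less_or_eq)
  have "card ?B = n" using Suc ne by (simp add: card_Diff_singleton)
  then have "(gmono ?B :: 'k grassmann) = prod_list (map gen (sorted_list_of_set ?B))"
    using Suc.hyps(1)[of ?B] Suc.prems by simp
  moreover have "sorted_list_of_set A = ?i # sorted_list_of_set ?B"
    using Suc.prems ne by (rule sorted_list_of_set_nonempty)
  moreover have "(gmono (insert ?i ?B) :: 'k grassmann) = gen ?i * gmono ?B"
    using Suc.prems less by (intro gmono_insert_least) auto
  ultimately show ?case using A by simp
qed

lemma grassmann_expansion: "a = (\<Sum>A | coeff a A \<noteq> 0. gscale (coeff a A) (gmono A))"
proof (rule grassmann_eqI)
  fix C :: "nat set" assume fin: "finite C"
  have "coeff (\<Sum>A | coeff a A \<noteq> 0. gscale (coeff a A) (gmono A)) C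
      = (\<Sum>A | coeff a A \<noteq> 0. if A = C then coeff a C else 0)"
    unfolding coeff_sum by (intro sum.cong) (auto simp: gmono.rep_eq fin)
  also have "\<dots> = coeff a C" by (simp add: sum.delta')
  finally show "coeff a C = coeff (\<Sum>A | coeff a A \<noteq> 0. gscale (coeff a A) (gmono A)) C" by simp
qed

text \<open>Degrees are natural numbers read modulo 2.\<close>

definition gdeg :: "nat \<Rightarrow> 'k::field grassmann set" where
  "gdeg d = {a. \<forall>A. coeff a A \<noteq> 0 \<longrightarrow> card A mod 2 = d mod 2}"


section \<open>The superalgebra of endomorphisms\<close>

typedef (overloaded) 'k gend =
  "{T :: 'k::field grassmann \<Rightarrow> 'k grassmann. Vector_Spaces.linear gscale gscale T}"
  morphisms app Abs_gend
  by (rule exI[of _ id]) (simp add: Grassmann.linear_id)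

setup_lifting type_definition_gend

interpretation app: Vector_Spaces.linear gscale gscale "app T"
  using app[of T] by simp

lemma gend_eqI: "(\<And>a. app S a = app T a) \<Longrightarrow> S = T"
  by (simp add: app_inject[symmetric] fun_eq_iff)

lemma linear_gscaleI:
  assumes "\<And>a b. T (a + b) = T a + T b" "\<And>c a. T (gscale c a) = gscale c (T a)"
  shows "Vector_Spaces.linear gscale gscale (T :: 'k::field grassmann \<Rightarrow> 'k grassmann)"
  using assms by unfold_locales auto

interpretation Grassmann_pair: vector_space_pair gscale gscale ..

instantiation gend :: (field) ring_1
begin

lift_definition zero_gend :: "'a gend" is "\<lambda>_. 0"
  by (rule linear_gscaleI) auto

lift_definition one_gend :: "'a gend" is id
  by (rule Grassmann.linear_id)

lift_definition plus_gend :: "'a gend \<Rightarrow> 'a gend \<Rightarrow> 'a gend" is "\<lambda>S T a. S a + T a"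
  by (rule Grassmann_pair.linear_compose_add)

lift_definition minus_gend :: "'a gend \<Rightarrow> 'a gend \<Rightarrow> 'a gend" is "\<lambda>S T a. S a - T a"
  by (rule Grassmann_pair.linear_compose_sub)

lift_definition uminus_gend :: "'a gend \<Rightarrow> 'a gend" is "\<lambda>T a. - T a"
  by (rule Grassmann_pair.linear_compose_neg)

lift_definition times_gend :: "'a gend \<Rightarrow> 'a gend \<Rightarrow> 'a gend" is "\<lambda>S T. S \<circ> T"
  by (rule Vector_Spaces.linear_compose)

instance
proof
  fix R S T :: "'a gend"
  show "R + S + T = R + (S + T)" by transfer (simp add: add.assoc)
  show "R + S = S + R" by transfer (simp add: add.commute)
  show "0 + R = R" by transfer simp
  show "- R + R = 0" by transfer simp
  show "R - S = R + - S" by transfer simp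
  show "R * S * T = R * (S * T)" by transfer (simp add: comp_assoc)
  show "1 * R = R" by transfer simp
  show "R * 1 = R" by transfer simp
  show "(R + S) * T = R * T + S * T" by transfer (simp add: fun_eq_iff)
  show "R * (S + T) = R * S + R * T"
    by (rule gend_eqI) (simp add: times_gend.rep_eq plus_gend.rep_eq app.add)
  show "(0 :: 'a gend) \<noteq> 1" by transfer (metis id_apply one_neq_zero)
qed

end

lemma app_add_op [simp]: "app (S + T) a = app S a + app T a"
  by transfer simp

lemma app_diff_op [simp]: "app (S - T) a = app S a - app T a"
  by transfer simp

lemma app_minus_op [simp]: "app (- T) a = - app T a"
  by transfer simp

lemma app_zero_op [simp]: "app 0 a = 0"
  by transfer simp

lemma app_one_op [simp]: "app 1 a = a"
  by transfer simp

lemma app_mult_op [simp]: "app (S * T) a = app S (app T a)"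
  by transfer simp

lift_definition escale :: "'k::field \<Rightarrow> 'k gend \<Rightarrow> 'k gend" is "\<lambda>c T a. gscale c (T a)"
  by (rule Grassmann_pair.linear_compose_scale_right)

interpretation End: vector_space escale
  by unfold_locales (transfer; simp add: fun_eq_iff Grassmann.scale_right_distrib
      Grassmann.scale_left_distrib)+

lemma app_escale [simp]: "app (escale c T) a = gscale c (app T a)"
  by transfer simp

definition edeg :: "nat \<Rightarrow> 'k::field gend set" where
  "edeg s = {T. \<forall>d. \<forall>a \<in> gdeg d. app T a \<in> gdeg (d + s)}"

lift_definition gpart :: "nat \<Rightarrow> 'k::field grassmann \<Rightarrow> 'k grassmann"
  is "\<lambda>d a A. if card A mod 2 = d mod 2 then a A else 0"
  by (auto elim: rev_finite_subset)

definition gproj :: "nat \<Rightarrow> 'k::field gend" where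
  "gproj d = Abs_gend (gpart d)"

lemma app_gproj: "app (gproj d) = gpart d"
  unfolding gproj_def
  by (rule Abs_gend_inverse, rule CollectI, rule linear_gscaleI; transfer; simp add: fun_eq_iff)

lemma coeff_gproj [simp]:
  "coeff (app (gproj d) a) A = (if card A mod 2 = d mod 2 then coeff a A else 0)"
  unfolding app_gproj by transfer simp

text \<open>The component of degree \<open>s\<close> in \<open>End \<Lambda> = (End \<Lambda>)\<^sub>0 \<oplus> (End \<Lambda>)\<^sub>1\<close>.\<close>

definition epart :: "nat \<Rightarrow> 'k::field gend \<Rightarrow> 'k gend" where
  "epart s T = (\<Sum>d\<in>{0, 1}. gproj (d + s) * T * gproj d)"

text \<open>
  The bilinear extension of \<open>[S, T] = S T - (-1)\<^bsup>deg S deg T\<^esup> T S\<close> from homogeneous operators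
  (see \<open>supercommutator_homogeneous\<close>) to all of \<open>End \<Lambda>\<close>.
\<close>

definition supercommutator :: "'k::field gend \<Rightarrow> 'k gend \<Rightarrow> 'k gend" where
  "supercommutator S T =
     (\<Sum>s\<in>{0, 1}. \<Sum>t\<in>{0, 1}. epart s S * epart t T - (-1) ^ (s * t) * (epart t T * epart s S))"

lemma gproj_gdeg: "a \<in> gdeg d \<Longrightarrow> app (gproj e) a = (if d mod 2 = e mod 2 then a else 0)"
  by (rule grassmann_eqI) (auto simp: gdeg_def)

lemma gproj_in_gdeg: "app (gproj d) a \<in> gdeg d"
  by (auto simp: gdeg_def split: if_splits)

lemma gproj_sum: "app (gproj 0) a + app (gproj (Suc 0)) a = a"
  by (rule grassmann_eqI) (auto simp: mod2_eq_if)

lemma epart_homogeneous: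
  assumes "T \<in> edeg s"
  shows "epart t T = (if s mod 2 = t mod 2 then T else 0)"
proof (rule gend_eqI)
  fix a
  have *: "app T (app (gproj d) a) \<in> gdeg (d + s)" for d
    using assms gproj_in_gdeg by (auto simp: edeg_def)
  have eq: "(d + s) mod 2 = (d + t) mod 2 \<longleftrightarrow> s mod 2 = t mod 2" for d by presburger
  have "app (epart t T) a = (\<Sum>d\<in>{0, 1}. app (gproj (d + t)) (app T (app (gproj d) a)))"
    by (simp add: epart_def)
  also have "\<dots> = (if s mod 2 = t mod 2 then app T (app (gproj 0) a + app (gproj (Suc 0)) a) else 0)"
    using gproj_gdeg[OF *[of 0], of t] gproj_gdeg[OF *[of 1], of "1 + t"]
    by (simp only: eq) (simp add: app.add)
  finally show "app (epart t T) a = app (if s mod 2 = t mod 2 then T else 0) a"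
    by (simp add: gproj_sum)
qed

lemma epart_sum: "epart 0 T + epart 1 T = T"
proof (rule gend_eqI)
  fix a
  have g: "gproj 2 = gproj 0"
    by (rule gend_eqI, rule grassmann_eqI) simp
  let ?u = "app T (app (gproj 0) a)" and ?w = "app T (app (gproj (Suc 0)) a)"
  have "app (epart 0 T + epart 1 T) a
      = (app (gproj 0) ?u + app (gproj (Suc 0)) ?u) + (app (gproj 0) ?w + app (gproj (Suc 0)) ?w)"
    by (simp add: epart_def g numeral_2_eq_2[symmetric] add_ac)
  also have "\<dots> = ?u + ?w" by (simp only: gproj_sum)
  also have "\<dots> = app T a" using gproj_sum[of a] by (simp add: app.add[symmetric])
  finally show "app (epart 0 T + epart 1 T) a = app T a" .
qed

lemma supercommutator_homogeneous:
  assumes "S \<in> edeg s" "T \<in> edeg t"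
  shows "supercommutator S T = S * T - (-1) ^ (s * t) * (T * S)"
  using assms
  by (cases "even s"; cases "even t")
    (simp_all add: supercommutator_def epart_homogeneous mod2_eq_if)

definition lie_superalgebra :: "'k::field gend set \<Rightarrow> 'k gend set" where
  "lie_superalgebra G = \<Inter> {L. End.subspace L \<and> G \<subseteq> L \<and>
     (\<forall>S\<in>L. \<forall>T\<in>L. supercommutator S T \<in> L)}"


section \<open>Left multiplications and odd superderivations\<close>

definition lmult :: "'k::field grassmann \<Rightarrow> 'k gend" where
  "lmult a = Abs_gend (\<lambda>b. a * b)"

lemma app_lmult [simp]: "app (lmult a) b = a * b"
  unfolding lmult_def
  by (subst Abs_gend_inverse)
    (auto intro!: linear_gscaleI simp: distrib_left gscale_mult_right)

lemma lmult_mult: "lmult (a * b) = lmult a * lmult b"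
  by (rule gend_eqI) (simp add: mult.assoc)

definition mul_x :: "nat \<Rightarrow> 'k::field gend" where
  "mul_x i = lmult (gen i)"

definition odd_superderivation :: "'k::field gend \<Rightarrow> bool" where
  "odd_superderivation D \<longleftrightarrow> D \<in> edeg 1 \<and>
     (\<forall>d. \<forall>a \<in> gdeg d. \<forall>b. app D (a * b) = app D a * b + (-1) ^ d * a * app D b)"

definition pd :: "nat \<Rightarrow> 'k::field gend" where
  "pd i = (THE D. odd_superderivation D \<and> (\<forall>j. app D (gen j) = (if i = j then 1 else 0)))"

text \<open>Existence and uniqueness of \<open>pd i\<close>, by way of its coordinates.\<close>

lift_definition gder :: "nat \<Rightarrow> 'k::field grassmann \<Rightarrow> 'k grassmann"
  is "\<lambda>i a C. if i \<in> C then 0 else inv_sign {i} C * a (insert i C)"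
proof goal_cases
  case (1 i a)
  have "{C. (if i \<in> C then 0 else inv_sign {i} C * a (insert i C)) \<noteq> 0}
      \<subseteq> (\<lambda>A. A - {i}) ` {A. a A \<noteq> 0}"
  proof
    fix C assume "C \<in> {C. (if i \<in> C then 0 else inv_sign {i} C * a (insert i C)) \<noteq> 0}"
    then have "i \<notin> C" "a (insert i C) \<noteq> 0" by (auto split: if_splits)
    then show "C \<in> (\<lambda>A. A - {i}) ` {A. a A \<noteq> 0}"
      by (intro image_eqI[of _ _ "insert i C"]) auto
  qed
  with 1 show ?case by (auto intro: finite_subset split: if_splits)
qed

definition gder_op :: "nat \<Rightarrow> 'k::field gend" where
  "gder_op i = Abs_gend (gder i)"

lemma coeff_gder_op:
  "coeff (app (gder_op i) a) C = (if i \<in> C then 0 else inv_sign {i} C * coeff a (insert i C))"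
proof -
  have "app (gder_op i) = (gder i :: 'a grassmann \<Rightarrow> _)"
    unfolding gder_op_def
    by (rule Abs_gend_inverse, rule CollectI, rule linear_gscaleI; transfer)
      (simp_all add: fun_eq_iff algebra_simps)
  then show ?thesis by (simp add: gder.rep_eq)
qed

lemma inv_sign_square: "inv_sign A B * inv_sign A B = (1 :: 'k::field)"
  by (simp add: inv_sign_def power_mult_distrib[symmetric])

lemma inv_sign_swap:
  assumes "finite A" "i \<notin> A"
  shows "inv_sign A {i} * inv_sign {i} A = ((-1) ^ card A :: 'k::field)"
proof -
  have "i < j \<or> j < i" if "j \<in> A" for j using that assms(2) by (metis nat_neq_iff)
  then have "A = {j \<in> A. i < j} \<union> {j \<in> A. j < i}" by blast
  then have "card A = card ({j \<in> A. i < j} \<union> {j \<in> A. j < i})" by simp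
  also have "\<dots> = card {j \<in> A. i < j} + card {j \<in> A. j < i}"
    using assms(1) by (intro card_Un_disjoint) auto
  finally have "card A = card {j \<in> A. i < j} + card {j \<in> A. j < i}" .
  then show ?thesis by (simp add: inv_sign_single_left inv_sign_single_right power_add)
qed

lemma gder_op_gmono:
  assumes "finite A"
  shows "app (gder_op i) (gmono A) =
    (if i \<in> A then gscale (inv_sign {i} (A - {i})) (gmono (A - {i})) else (0 :: 'k::field grassmann))"
proof (rule grassmann_eqI)
  fix C :: "nat set" assume "finite C"
  have "i \<notin> C \<and> insert i C = A \<longleftrightarrow> i \<in> A \<and> C = A - {i}" by blast
  then show "coeff (app (gder_op i) (gmono A)) C = coeff (if i \<in> A
      then gscale (inv_sign {i} (A - {i})) (gmono (A - {i})) else (0 :: 'k grassmann)) C"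
    using assms by (auto simp: coeff_gder_op gmono.rep_eq)
qed

lemma gder_op_gmono_mult:
  fixes A B :: "nat set"
  assumes fin: "finite A" "finite B"
  shows "app (gder_op i) (gmono A * gmono B) = app (gder_op i) (gmono A) * gmono B
    + gscale ((-1) ^ card A) (gmono A * app (gder_op i) (gmono B) :: 'k::field grassmann)"
proof -
  define A' B' where "A' = A - {i}" and "B' = B - {i}"
  have fin': "finite A'" "finite B'" "finite {i}" and ni: "i \<notin> A'" "i \<notin> B'"
    using fin by (auto simp: A'_def B'_def)
  note expand = inv_sign_Un_left inv_sign_Un_right
  consider "i \<notin> A" "i \<notin> B" | "i \<in> A" "i \<notin> B" | "i \<notin> A" "i \<in> B" | "i \<in> A" "i \<in> B" by blast
  then show ?thesis
  proof cases
    case 1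
    with fin show ?thesis by (simp add: gmono_mult gder_op_gmono app.scale)
  next
    case 2
    then have A: "A = {i} \<union> A'" by (auto simp: A'_def)
    show ?thesis
    proof (cases "A' \<inter> B = {}")
      case True
      have U: "A \<union> B - {i} = A' \<union> B" and AB: "A \<inter> B = {}" using A 2 ni True by auto
      have "inv_sign A B * inv_sign {i} (A' \<union> B)
          = inv_sign {i} A' * inv_sign A' B * (inv_sign {i} B * inv_sign {i} B :: 'k)"
        unfolding A using fin fin' ni True by (simp add: expand del: Un_insert_left)
      with 2 fin fin' True AB show ?thesis
        by (simp add: gmono_mult gder_op_gmono app.scale U A'_def[symmetric] inv_sign_square
            gscale_mult_left)
    next
      case False
      then have "A \<inter> B \<noteq> {}" using A by auto
      with 2 fin fin' False show ?thesis
        by (simp add: gmono_mult gder_op_gmono app.zero A'_def[symmetric] gscale_mult_left)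
    qed
  next
    case 3
    then have B: "B = {i} \<union> B'" by (auto simp: B'_def)
    show ?thesis
    proof (cases "A \<inter> B' = {}")
      case True
      have U: "A \<union> B - {i} = A \<union> B'" and AB: "A \<inter> B = {}" using B 3 ni True by auto
      have "inv_sign A B * inv_sign {i} (A \<union> B')
          = (inv_sign A {i} * inv_sign {i} A) * inv_sign A B' * (inv_sign {i} B' :: 'k)"
        unfolding B using fin fin' ni True by (simp add: expand del: Un_insert_left)
      with 3 fin fin' True AB show ?thesis
        by (simp add: gmono_mult gder_op_gmono app.scale U B'_def[symmetric] inv_sign_swap
            gscale_mult_right mult_ac)
    next
      case False
      then have "A \<inter> B \<noteq> {}" using B by auto
      with 3 fin fin' False show ?thesis
        by (simp add: gmono_mult gder_op_gmono app.zero B'_def[symmetric] gscale_mult_right)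
    qed
  next
    case 4
    then have A: "A = {i} \<union> A'" and B: "B = {i} \<union> B'" by (auto simp: A'_def B'_def)
    have AB: "A \<inter> B \<noteq> {}" using 4 by auto
    have int: "A' \<inter> B = A' \<inter> B'" "A \<inter> B' = A' \<inter> B'" using ni by (auto simp: A B)
    show ?thesis
    proof (cases "A' \<inter> B' = {}")
      case True
      have U: "A' \<union> B = A \<union> B'" by (auto simp: A B)
      have card: "card A = Suc (card A')" unfolding A using fin' ni by simp
      have "inv_sign {i} A' * inv_sign A' B = (inv_sign A' {i} * inv_sign {i} A') * (inv_sign A' B' :: 'k)"
        unfolding B using fin' ni by (simp add: expand del: Un_insert_left)
      also have "\<dots> = (-1) ^ card A' * inv_sign A' B'"
        using fin' ni by (simp add: inv_sign_swap)
      finally have 1: "inv_sign {i} A' * inv_sign A' B = (-1) ^ card A' * (inv_sign A' B' :: 'k)" .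
      have "inv_sign {i} B' * inv_sign A B' = (inv_sign {i} B' * inv_sign {i} B') * (inv_sign A' B' :: 'k)"
        unfolding A using fin' ni by (simp add: expand del: Un_insert_left)
      then have 2: "inv_sign {i} B' * inv_sign A B' = (inv_sign A' B' :: 'k)"
        by (simp add: inv_sign_square)
      show ?thesis using 4 fin fin' True AB int
        by (simp add: gmono_mult gder_op_gmono app.zero A'_def[symmetric] B'_def[symmetric]
            gscale_mult_left gscale_mult_right U 1 2 card Grassmann.scale_left_distrib[symmetric])
    next
      case False
      with 4 fin fin' AB int show ?thesis
        by (simp add: gmono_mult gder_op_gmono app.zero A'_def[symmetric] B'_def[symmetric]
            gscale_mult_left gscale_mult_right)
    qed
  qed
qed

lemma minus_one_power_mult: "(-1) ^ n * a = gscale ((-1) ^ n) a"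
proof (induction n)
  case (Suc n)
  have "(-1) ^ Suc n * a = - ((-1) ^ n * a)" by simp
  then show ?case using Suc by simp
qed simp

lemma superderivation_gder_op: "odd_superderivation (gder_op i :: 'k::field gend)"
  unfolding odd_superderivation_def
proof (intro conjI allI ballI)
  show "(gder_op i :: 'k gend) \<in> edeg 1"
    unfolding edeg_def
  proof (intro CollectI allI ballI)
    fix d and a :: "'k grassmann" assume a: "a \<in> gdeg d"
    show "app (gder_op i) a \<in> gdeg (d + 1)"
      unfolding gdeg_def
    proof (intro CollectI allI impI)
      fix C assume "coeff (app (gder_op i) a) C \<noteq> 0"
      then have C: "i \<notin> C" "coeff a (insert i C) \<noteq> 0"
        by (auto simp: coeff_gder_op split: if_splits)
      then have "finite C" using coeff_nonzero_finite[OF C(2)] by simp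
      moreover have "card (insert i C) mod 2 = d mod 2" using a C by (auto simp: gdeg_def)
      ultimately have "Suc (card C) mod 2 = d mod 2" using C by simp
      then show "card C mod 2 = (d + 1) mod 2" by presburger
    qed
  qed
next
  fix d and a b :: "'k grassmann" assume a: "a \<in> gdeg d"
  let ?D = "app (gder_op i) :: 'k grassmann \<Rightarrow> _"
  have mono: "?D (gscale (coeff a A) (gmono A) * gscale (coeff b B) (gmono B))
      = ?D (gscale (coeff a A) (gmono A)) * gscale (coeff b B) (gmono B)
        + gscale ((-1) ^ d) (gscale (coeff a A) (gmono A) * ?D (gscale (coeff b B) (gmono B)))"
    if "coeff a A \<noteq> 0" "coeff b B \<noteq> 0" for A B
  proof -
    have "finite A" "finite B" using that by (simp_all add: coeff_nonzero_finite)
    moreover have "(-1) ^ card A = ((-1) ^ d :: 'k)"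
      using a that(1) by (auto simp: gdeg_def minus_one_power_iff even_iff_mod_2_eq_zero)
    ultimately show ?thesis
      by (simp add: app.scale gscale_mult_left gscale_mult_right gder_op_gmono_mult
          Grassmann.scale_right_distrib mult_ac)
  qed
  let ?a = "\<lambda>A. gscale (coeff a A) (gmono A)" and ?b = "\<lambda>B. gscale (coeff b B) (gmono B)"
  let ?I = "{A. coeff a A \<noteq> 0}" and ?J = "{B. coeff b B \<noteq> 0}"
  have "?D (sum ?a ?I * sum ?b ?J) = (\<Sum>A\<in>?I. \<Sum>B\<in>?J. ?D (?a A * ?b B))"
    by (simp add: sum_product app.sum)
  also have "\<dots> = (\<Sum>A\<in>?I. \<Sum>B\<in>?J. ?D (?a A) * ?b B + gscale ((-1) ^ d) (?a A * ?D (?b B)))"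
    by (intro sum.cong refl mono) auto
  also have "\<dots> = ?D (sum ?a ?I) * sum ?b ?J + gscale ((-1) ^ d) (sum ?a ?I * ?D (sum ?b ?J))"
    by (simp add: sum.distrib sum_product app.sum Grassmann.scale_sum_right)
  finally show "?D (a * b) = ?D a * b + (-1) ^ d * a * ?D b"
    by (simp add: grassmann_expansion[symmetric] gscale_mult_left minus_one_power_mult)
qed

lemma odd_superderivation_unique:
  fixes D E :: "'k::field gend"
  assumes D: "odd_superderivation D" and E: "odd_superderivation E"
    and gens: "\<And>j. app D (gen j) = app E (gen j)"
  shows "D = E"
proof (rule gend_eqI)
  have one: "app F 1 = 0" if "odd_superderivation F" for F :: "'k gend"
  proof -
    have "(1 :: 'k grassmann) \<in> gdeg 0" by (auto simp: gdeg_def one_grassmann.rep_eq split: if_splits)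
    with that have "app F (1 * 1) = app F 1 * 1 + (-1) ^ 0 * 1 * app F 1"
      unfolding odd_superderivation_def by blast
    then show ?thesis by simp
  qed
  have mult: "app F (gen j * a) = app F (gen j) * a - gen j * app F a"
    if "odd_superderivation F" for F :: "'k gend" and j a
  proof -
    have "(gen j :: 'k grassmann) \<in> gdeg 1"
      by (auto simp: gdeg_def gen_def gmono.rep_eq split: if_splits)
    with that have "app F (gen j * a) = app F (gen j) * a + (-1) ^ 1 * gen j * app F a"
      unfolding odd_superderivation_def by blast
    then show ?thesis by simp
  qed
  have mono: "app D (gmono A) = app E (gmono A)" if "finite A" for A
    using that
  proof (induction A rule: finite_linorder_min_induct)
    case empty then show ?case by (simp add: one D E)
  next
    case (insert i A)
    then show ?case by (simp add: gmono_insert_least mult D E gens)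
  qed
  fix a
  have "app D (\<Sum>A | coeff a A \<noteq> 0. gscale (coeff a A) (gmono A))
      = app E (\<Sum>A | coeff a A \<noteq> 0. gscale (coeff a A) (gmono A))"
    unfolding app.sum app.scale
    by (intro sum.cong refl) (simp add: mono coeff_nonzero_finite)
  then show "app D a = app E a" by (simp add: grassmann_expansion[symmetric])
qed

lemma gder_op_gen: "app (gder_op i) (gen j) = (if i = j then 1 else 0)"
  by (auto simp: gen_def gder_op_gmono)

lemma pd_eq_gder_op: "pd i = (gder_op i :: 'k::field gend)"
  unfolding pd_def
proof (rule the_equality)
  show "odd_superderivation (gder_op i :: 'k::field gend) \<and>
      (\<forall>j. app (gder_op i :: 'k gend) (gen j) = (if i = j then 1 else 0))"
    by (simp add: superderivation_gder_op gder_op_gen)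
next
  fix D :: "'k gend"
  assume "odd_superderivation D \<and> (\<forall>j. app D (gen j) = (if i = j then 1 else 0))"
  then show "D = gder_op i"
    by (intro odd_superderivation_unique superderivation_gder_op) (simp_all only: gder_op_gen)
qed

lemma odd_superderivation_pd: "odd_superderivation (pd i)"
  by (simp add: pd_eq_gder_op superderivation_gder_op)

lemma pd_gen: "app (pd i) (gen j) = (if i = j then 1 else 0)"
  by (simp add: pd_eq_gder_op gder_op_gen)

lemma coeff_pd:
  "coeff (app (pd i) a) C = (if i \<in> C then 0 else inv_sign {i} C * coeff a (insert i C))"
  by (simp add: pd_eq_gder_op coeff_gder_op)


section \<open>The pivot elements\<close>

text \<open>
  The operator \<open>pivot i\<close> agrees on each element of \<open>\<Lambda>\<close> with all sufficiently long truncations of the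
  infinite nested expression (\<open>pivot_limit\<close>, \<open>pivot_rec\<close>); \<open>pivot_trunc n i\<close> keeps the first \<open>n\<close> terms of \<open>v\<^sub>i = \<partial>\<^sub>i + x\<^sub>i x\<^bsub>i+1\<^esub> (\<partial>\<^bsub>i+2\<^esub> + x\<^bsub>i+2\<^esub> x\<^bsub>i+3\<^esub> (\<dots>))\<close>.
\<close>

fun pivot_trunc :: "nat \<Rightarrow> nat \<Rightarrow> 'k::field gend" where
  "pivot_trunc 0 i = 0"
| "pivot_trunc (Suc n) i = pd i + mul_x i * mul_x (i + 1) * pivot_trunc n (i + 2)"

definition pivot :: "nat \<Rightarrow> 'k::field gend" where
  "pivot i = (THE T. \<forall>a. \<forall>\<^sub>F n in sequentially. app T a = app (pivot_trunc n i) a)"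

lemma pivot_trunc_Suc:
  assumes "\<And>A j. coeff a A \<noteq> 0 \<Longrightarrow> j \<in> A \<Longrightarrow> j < i + 2 * n"
  shows "app (pivot_trunc (Suc n) i) a = app (pivot_trunc n i) a"
  using assms
proof (induction n arbitrary: i)
  case 0
  then have "coeff a (insert i C) = 0" for C by fastforce
  then have "app (pd i) a = 0" by (intro grassmann_eqI) (simp add: coeff_pd)
  then show ?case by (simp add: app.zero)
next
  case (Suc n)
  have "app (pivot_trunc (Suc n) (i + 2)) a = app (pivot_trunc n (i + 2)) a"
    by (rule Suc.IH) (use Suc.prems in fastforce)
  then show ?case unfolding pivot_trunc.simps(2)[of _ i] by simp
qed

lemma pivot_trunc_stable:
  "\<exists>N. \<forall>n\<ge>N. app (pivot_trunc n i) a = app (pivot_trunc N i) a"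
proof -
  have "finite (\<Union> {A. coeff a A \<noteq> 0})"
    by (rule finite_Union) (auto intro: coeff_nonzero_finite)
  then obtain N where "\<forall>j \<in> \<Union> {A. coeff a A \<noteq> 0}. j < N"
    unfolding finite_nat_set_iff_bounded by blast
  then have N: "j < N" if "coeff a A \<noteq> 0" "j \<in> A" for A j using that by blast
  have "app (pivot_trunc n i) a = app (pivot_trunc N i) a" if "n \<ge> N" for n
    using that
  proof (induction n rule: dec_induct)
    case (step n)
    have "app (pivot_trunc (Suc n) i) a = app (pivot_trunc n i) a"
      by (rule pivot_trunc_Suc) (use N step.hyps in \<open>fastforce dest: order_less_le_trans\<close>)
    with step show ?case by simp
  qed simp
  then show ?thesis by blast
qed

lemma pivot_exists:
  "\<exists>T :: 'k::field gend. \<forall>a. \<forall>\<^sub>F n in sequentially. app T a = app (pivot_trunc n i) a"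
proof -
  obtain N where "\<forall>a. \<forall>n\<ge>N a.
      app (pivot_trunc n i) a = (app (pivot_trunc (N a) i) a :: 'k grassmann)"
    using choice[of "\<lambda>a N. \<forall>n\<ge>N.
      app (pivot_trunc n i) a = (app (pivot_trunc N i) a :: 'k grassmann)"]
      pivot_trunc_stable[of i] by blast
  then have N: "app (pivot_trunc n i) a = (app (pivot_trunc (N a) i) a :: 'k grassmann)"
    if "n \<ge> N a" for a n using that by blast
  define T where "T a = (app (pivot_trunc (N a) i) a :: 'k grassmann)" for a
  have T: "T a = app (pivot_trunc n i) a" if "n \<ge> N a" for a n
    using N[OF that] by (simp add: T_def)
  have "Vector_Spaces.linear gscale gscale T"
  proof (rule linear_gscaleI)
    fix a b
    let ?n = "max (N (a + b)) (max (N a) (N b))"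
    show "T (a + b) = T a + T b"
      using T[of "a + b" ?n] T[of a ?n] T[of b ?n] by (simp add: app.add)
  next
    fix c a
    let ?n = "max (N (gscale c a)) (N a)"
    show "T (gscale c a) = gscale c (T a)"
      using T[of "gscale c a" ?n] T[of a ?n] by (simp add: app.scale)
  qed
  then have "app (Abs_gend T) = T" by (simp add: Abs_gend_inverse)
  then have "\<forall>a. \<forall>\<^sub>F n in sequentially. app (Abs_gend T) a = app (pivot_trunc n i) a"
    using T by (auto simp: eventually_sequentially)
  then show ?thesis by blast
qed

lemma pivot_limit: "\<forall>\<^sub>F n in sequentially. app (pivot i) a = app (pivot_trunc n i) a"
proof -
  have "\<exists>!T :: 'a gend. \<forall>a. \<forall>\<^sub>F n in sequentially. app T a = app (pivot_trunc n i) a"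
  proof (rule ex_ex1I[OF pivot_exists])
    fix S T :: "'a gend"
    assume S: "\<forall>a. \<forall>\<^sub>F n in sequentially. app S a = app (pivot_trunc n i) a"
      and T: "\<forall>a. \<forall>\<^sub>F n in sequentially. app T a = app (pivot_trunc n i) a"
    show "S = T"
    proof (rule gend_eqI)
      fix a
      have "\<forall>\<^sub>F n in sequentially. app S a = app T a"
        using S[rule_format, of a] T[rule_format, of a] by eventually_elim simp
      then show "app S a = app T a" by simp
    qed
  qed
  from theI'[OF this] show ?thesis unfolding pivot_def by blast
qed

lemma pivot_rec: "(pivot i :: 'k::field gend) = pd i + mul_x i * mul_x (i + 1) * pivot (i + 2)"
proof (rule gend_eqI)
  fix a :: "'k grassmann"
  have "\<forall>\<^sub>F n in sequentially. app (pivot i) a = app (pivot_trunc (Suc n) i) a"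
    using pivot_limit[of i a] unfolding eventually_sequentially by (meson le_SucI)
  then have "\<forall>\<^sub>F n in sequentially. app (pivot i) a = app (pd i + mul_x i * mul_x (i + 1) * pivot (i + 2)) a"
    using pivot_limit[of "i + 2" a] by eventually_elim simp
  then show "app (pivot i) a = app (pd i + mul_x i * mul_x (i + 1) * pivot (i + 2)) a" by simp
qed


section \<open>Standard monomials\<close>

text \<open>
  The tail monomials \<open>r\<^sub>m\<close>; the index is an integer because \<open>r\<^sub>m = 1\<close> also occurs for \<open>m < 0\<close>,
  where the list \<open>[0..m]\<close> is empty.
\<close>

definition tail_monomials :: "int \<Rightarrow> 'k::field gend set" where
  "tail_monomials m =
     {prod_list (map (\<lambda>i. mul_x (nat i) ^ \<xi> (nat i)) [0..m]) | \<xi>. \<forall>i. \<xi> i \<in> {0, 1}}"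

lemma tail_monomials_neg: "m < 0 \<Longrightarrow> tail_monomials m = {1}"
  by (auto simp: tail_monomials_def)

definition standard_monomials_1 :: "'k::field gend set" where
  "standard_monomials_1 = {r * pivot n | r n. r \<in> tail_monomials (int n - 2)}"

definition standard_monomials_2 :: "'k::field gend set" where
  "standard_monomials_2 =
     {r * mul_x (n - 1) * pivot n | r n. 2 \<le> n \<and> r \<in> tail_monomials (int n - 3)}
     - {mul_x 0 * mul_x 2 * pivot 3}"

definition lie_R :: "'k::field gend set" where
  "lie_R = lie_superalgebra {pivot 0, pivot 1}"

end

theory Submission
  imports Defs
begin

text \<open>
  Let \<open>n \<le> m\<close>, and let \<open>f\<close>, \<open>g\<close> be monomials in the letters \<open>x\<^sub>i\<close> with \<open>i < n\<close> and \<open>i < m\<close>. Since \<open>v\<^sub>m\<close>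
  annihilates \<open>f\<close>, one has \<open>[f v\<^sub>n, g v\<^sub>m] = f v\<^sub>n(g) v\<^sub>m \<plusminus> f g [v\<^sub>n, v\<^sub>m]\<close>, and
  \<open>[v\<^sub>n, v\<^sub>n] = 2 x\<^bsub>n+1\<^esub> v\<^bsub>n+2\<^esub>\<close>, \<open>[v\<^sub>n, v\<^bsub>n+1\<^esub>] = - x\<^sub>n v\<^bsub>n+2\<^esub>\<close>,
  \<open>[v\<^sub>n, v\<^sub>m] = x\<^sub>n x\<^bsub>n+1\<^esub> [v\<^bsub>n+2\<^esub>, v\<^sub>m]\<close> for \<open>m \<ge> n + 2\<close>. Hence the span of the standard monomials is
  closed under brackets. Conversely, bracketing \<open>f v\<^bsub>k+1\<^esub>\<close> with \<open>v\<^sub>k\<close> gives \<open>f x\<^sub>k v\<^bsub>k+2\<^esub>\<close>, a further bracket with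
  \<open>v\<^sub>k\<close> removes \<open>x\<^sub>k\<close>, and the squares of the \<open>v\<^sub>k\<close> give the second type, which needs
  \<open>2 \<noteq> 0\<close>. Independence follows by evaluating a linear relation at \<open>x\<^sub>N\<close> for the least head
  \<open>v\<^sub>N\<close> in it, as \<open>v\<^sub>N(x\<^sub>N) = 1\<close> and \<open>v\<^sub>n(x\<^sub>N) = 0\<close> for \<open>n > N\<close>.
\<close>

section \<open>Supports and degrees\<close>

text \<open>The Grassmann subalgebra of Lambda on the letters with index in
  \<open>B\<close>.\<close>

definition supported :: "nat set \<Rightarrow> 'k::field grassmann set" where
  "supported B = {a. \<forall>A. coeff a A \<noteq> 0 \<longrightarrow> A \<subseteq> B}"

lemma supported_mono: "a \<in> supported B \<Longrightarrow> B \<subseteq> C \<Longrightarrow> a \<in> supported C"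
  by (auto simp: supported_def)

lemma supported_zero [simp]: "0 \<in> supported B"
  by (simp add: supported_def)

lemma supported_add: "a \<in> supported B \<Longrightarrow> b \<in> supported B \<Longrightarrow> a + b \<in> supported B"
  unfolding supported_def by simp (metis add.left_neutral)

lemma supported_gscale: "a \<in> supported B \<Longrightarrow> gscale c a \<in> supported B"
  by (auto simp: supported_def)

lemma supported_gmono: "A \<subseteq> B \<Longrightarrow> gmono A \<in> supported B"
  by (auto simp: supported_def gmono.rep_eq split: if_splits)

lemma supported_gen: "i \<in> B \<Longrightarrow> gen i \<in> supported B"
  by (simp add: gen_def supported_gmono)

lemma supported_one [simp]: "1 \<in> supported B"
  using supported_gmono[of "{}" B] by simp

lemma coeff_mult_nonzero:
  assumes "coeff (a * b) C \<noteq> 0"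
  obtains A where "A \<subseteq> C" "coeff a A \<noteq> 0" "coeff b (C - A) \<noteq> 0"
proof -
  have "(\<Sum>A\<in>Pow C. inv_sign A (C - A) * coeff a A * coeff b (C - A)) \<noteq> 0"
    using assms by (simp add: times_grassmann.rep_eq)
  then obtain A where "A \<in> Pow C" "inv_sign A (C - A) * coeff a A * coeff b (C - A) \<noteq> 0"
    by (metis (no_types, lifting) sum.neutral)
  then show thesis by (intro that[of A]) auto
qed

lemma supported_mult:
  assumes "a \<in> supported B" "b \<in> supported B"
  shows "a * b \<in> supported B"
  unfolding supported_def
proof (intro CollectI allI impI)
  fix C assume "coeff (a * b) C \<noteq> 0"
  then obtain A where "A \<subseteq> C" "coeff a A \<noteq> 0" "coeff b (C - A) \<noteq> 0" by (rule coeff_mult_nonzero)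
  with assms have "A \<subseteq> B" "C - A \<subseteq> B" by (auto simp: supported_def)
  then show "C \<subseteq> B" by blast
qed

lemma gdeg_mult:
  assumes "a \<in> gdeg p" "b \<in> gdeg q"
  shows "a * b \<in> gdeg (p + q)"
  unfolding gdeg_def
proof (intro CollectI allI impI)
  fix C assume C: "coeff (a * b) C \<noteq> 0"
  then obtain A where A: "A \<subseteq> C" "coeff a A \<noteq> 0" "coeff b (C - A) \<noteq> 0" by (rule coeff_mult_nonzero)
  with assms have "card A mod 2 = p mod 2" "card (C - A) mod 2 = q mod 2" by (auto simp: gdeg_def)
  moreover have "card C = card A + card (C - A)"
    using coeff_nonzero_finite[OF C] A(1)
    by (metis card_Diff_subset card_mono finite_subset le_add_diff_inverse)
  ultimately show "card C mod 2 = (p + q) mod 2" by (metis mod_add_cong)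
qed

lemma gdeg_cong: "p mod 2 = q mod 2 \<Longrightarrow> gdeg p = gdeg q"
  by (simp add: gdeg_def)

lemma gmono_gdeg: "gmono A \<in> gdeg (card A)"
  by (auto simp: gdeg_def gmono.rep_eq split: if_splits)

lemma gen_gdeg: "gen i \<in> gdeg 1"
  using gmono_gdeg[of "{i}"] by (simp add: gen_def)

lemma gdeg_add: "a \<in> gdeg d \<Longrightarrow> b \<in> gdeg d \<Longrightarrow> a + b \<in> gdeg d"
  unfolding gdeg_def by simp (metis add.left_neutral)

text \<open>Each pair in \<open>A \<times> B\<close> is either an inversion of (A, B) or, after
  swapping, one of (B, A), so the two inversion counts add up to
  \<open>card A * card B\<close>.\<close>

lemma inv_sign_transpose:
  assumes "finite A" "finite B" "A \<inter> B = {}"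
  shows "inv_sign B A = (-1) ^ (card A * card B) * (inv_sign A B :: 'k::field)"
proof -
  let ?I = "{(i, j). i \<in> A \<and> j \<in> B \<and> j < i}" and ?J = "{(i, j). i \<in> B \<and> j \<in> A \<and> j < i}"
  have "A \<times> B = ?I \<union> prod.swap ` ?J"
    using assms(3) by (fastforce simp: image_iff)
  moreover have "?I \<inter> prod.swap ` ?J = {}" by auto
  ultimately have "card (A \<times> B) = card ?I + card (prod.swap ` ?J)"
    using assms by (simp add: card_Un_disjoint finite_inversions)
  then have "card A * card B = card ?I + card ?J"
    by (simp add: card_cartesian_product card_image)
  then have "(-1) ^ (card A * card B) * inv_sign A B = inv_sign B A * (inv_sign A B * inv_sign A B :: 'k)"
    by (simp add: inv_sign_def power_add)
  then show ?thesis by (simp add: inv_sign_square)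
qed

lemma gmono_commute:
  assumes "finite A" "finite B"
  shows "gmono B * gmono A = gscale ((-1) ^ (card A * card B)) (gmono A * gmono B)"
  using assms by (auto simp: gmono_mult Int_commute Un_commute inv_sign_transpose[of A B])

text \<open>Supercommutativity of Lambda. Both sides are bilinear, so monomials suffice, and there
  only the parities of the two cardinalities matter.\<close>

lemma graded_commute:
  assumes "a \<in> gdeg p" "b \<in> gdeg q"
  shows "b * a = (-1) ^ (p * q) * (a * b)"
proof -
  let ?a = "\<lambda>A. gscale (coeff a A) (gmono A)" and ?b = "\<lambda>B. gscale (coeff b B) (gmono B)"
  let ?I = "{A. coeff a A \<noteq> 0}" and ?J = "{B. coeff b B \<noteq> 0}"
  have "?b B * ?a A = gscale ((-1) ^ (p * q)) (?a A * ?b B)"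
    if "coeff a A \<noteq> 0" "coeff b B \<noteq> 0" for A B
  proof -
    have "card A mod 2 = p mod 2" "card B mod 2 = q mod 2"
      using assms that by (auto simp: gdeg_def)
    then have "even (card A * card B) \<longleftrightarrow> even (p * q)"
      by (metis even_mult_iff even_iff_mod_2_eq_zero)
    then have "(-1) ^ (card A * card B) = ((-1) ^ (p * q) :: 'a)"
      by (simp add: minus_one_power_iff)
    with that show ?thesis
      by (simp add: gscale_mult_left gscale_mult_right gmono_commute[of A B] coeff_nonzero_finite mult_ac)
  qed
  then have "sum ?b ?J * sum ?a ?I = gscale ((-1) ^ (p * q)) (sum ?a ?I * sum ?b ?J)"
    unfolding sum_product Grassmann.scale_sum_right
    by (subst sum.swap) (auto intro!: sum.cong)
  then show ?thesis by (simp add: grassmann_expansion[symmetric] minus_one_power_mult)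
qed

lemma gmono_insert_greatest:
  assumes "finite A" "\<And>j. j \<in> A \<Longrightarrow> j < i"
  shows "gmono (insert i A) = gmono A * gen i"
proof -
  have e: "{j \<in> A. i < j} = {}" and "i \<notin> A" using assms(2) by (auto dest: order_less_asym)
  then show ?thesis
    using assms(1) by (simp add: gen_def gmono_mult inv_sign_single_right e del: Collect_empty_eq)
qed


section \<open>Odd superderivations\<close>

lemma lmult_add: "lmult (a + b) = lmult a + lmult b"
  by (rule gend_eqI) (simp add: distrib_right)

lemma lmult_zero [simp]: "lmult 0 = 0"
  by (rule gend_eqI) simp

lemma lmult_one [simp]: "lmult 1 = 1"
  by (rule gend_eqI) simp

lemma lmult_minus: "lmult (- a) = - lmult a"
  by (rule gend_eqI) simp

lemma lmult_gscale: "lmult (gscale c a) = escale c (lmult a)"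
  by (rule gend_eqI) (simp add: gscale_mult_left)

lemma escale_mult_left: "escale c S * T = escale c (S * T)"
  by (rule gend_eqI) simp

lemma escale_mult_right: "S * escale c T = escale c (S * T)"
  by (rule gend_eqI) (simp add: app.scale)

lemma minus_one_power_escale: "(-1) ^ n * T = escale ((-1) ^ n) T"
  by (cases "even n") auto

lemma mul_x_anticommute: "mul_x i * mul_x j = - (mul_x j * mul_x i)"
  unfolding mul_x_def lmult_mult[symmetric] lmult_minus[symmetric] using gen_anticommute by metis

lemma mul_x_square [simp]: "mul_x i * mul_x i = 0"
  by (simp add: mul_x_def lmult_mult[symmetric])

text \<open>The Leibniz rule read as an identity of operators, so that \<open>D\<close> can be moved
  past left multiplications inside products.\<close>

lemma odd_superderivation_lmult:
  assumes "odd_superderivation D" "a \<in> gdeg d"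
  shows "D * lmult a = lmult (app D a) + (-1) ^ d * (lmult a * D)"
proof (rule gend_eqI)
  fix b
  have "app ((-1) ^ d * (lmult a * D)) b = (-1) ^ d * (a * app D b)"
    by (simp add: minus_one_power_escale minus_one_power_mult)
  with assms show "app (D * lmult a) b = app (lmult (app D a) + (-1) ^ d * (lmult a * D)) b"
    by (simp add: odd_superderivation_def mult.assoc)
qed

lemma odd_superderivation_mul_x:
  assumes "odd_superderivation D"
  shows "D * mul_x j = lmult (app D (gen j)) - mul_x j * D"
  using odd_superderivation_lmult[OF assms gen_gdeg, of j] by (simp add: mul_x_def)

lemma odd_superderivation_one:
  assumes "odd_superderivation D"
  shows "app D 1 = 0"
proof -
  have "1 \<in> gdeg 0" using gmono_gdeg[of "{}"] by simp
  from odd_superderivation_lmult[OF assms this] show ?thesis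
    by simp (metis app_lmult app_zero_op mult.right_neutral)
qed

lemma odd_superderivation_zero: "odd_superderivation 0"
  by (simp add: odd_superderivation_def edeg_def gdeg_def)

lemma odd_superderivation_add:
  assumes "odd_superderivation D" "odd_superderivation E"
  shows "odd_superderivation (D + E)"
  using assms by (auto simp: odd_superderivation_def edeg_def gdeg_add algebra_simps)

text \<open>An even element is central in Lambda, so it passes \<open>a\<close> without a sign. With
  e = x_i x_{i+1} this is the recursion step for truncated pivots.\<close>

lemma odd_superderivation_even_mult:
  assumes D: "odd_superderivation D" and e: "e \<in> gdeg 2"
  shows "odd_superderivation (lmult e * D)"
  unfolding odd_superderivation_def
proof (intro conjI allI ballI)
  show "lmult e * D \<in> edeg 1"
    unfolding edeg_def
  proof (intro CollectI allI ballI)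
    fix d and a :: "'a grassmann" assume "a \<in> gdeg d"
    then have "app D a \<in> gdeg (d + 1)" using D by (simp add: odd_superderivation_def edeg_def)
    from gdeg_mult[OF e this] have "e * app D a \<in> gdeg (2 + (d + 1))" .
    moreover have "gdeg (2 + (d + 1)) = (gdeg (d + 1) :: 'a grassmann set)" by (rule gdeg_cong) simp
    ultimately show "app (lmult e * D) a \<in> gdeg (d + 1)" by simp
  qed
next
  fix d and a b :: "'a grassmann" assume a: "a \<in> gdeg d"
  have "e * a = a * e" using graded_commute[OF a e] by (simp add: power_mult mult.commute[of d])
  moreover have "app D (a * b) = app D a * b + (-1) ^ d * a * app D b"
    using D a by (simp add: odd_superderivation_def)
  ultimately show "app (lmult e * D) (a * b) = app (lmult e * D) a * b + (-1) ^ d * a * app (lmult e * D) b"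
    by (simp add: distrib_left minus_one_power_mult gscale_mult_left gscale_mult_right mult.assoc)
      (metis mult.assoc)
qed

lemma pd_mul_x: "pd i * mul_x j = (if i = j then 1 else 0) - mul_x j * pd i"
  by (simp add: odd_superderivation_mul_x[OF odd_superderivation_pd] pd_gen)

lemma pd_anticommute: "pd i * pd j = - (pd j * pd i :: 'k::field gend)"
proof (rule gend_eqI, rule grassmann_eqI)
  fix a :: "'k grassmann" and C :: "nat set" assume fin: "finite C"
  have *: "inv_sign {k} (insert l C) = inv_sign {k} {l} * (inv_sign {k} C :: 'k)" if "l \<notin> C" for k l
    using inv_sign_Un_right[of "{l}" C "{k}"] fin that by simp
  have "inv_sign {i} {j} = - (inv_sign {j} {i} :: 'k)" if "i \<noteq> j"
    using inv_sign_transpose[of "{j}" "{i}", where 'k = 'k] that by simp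
  then show "coeff (app (pd i * pd j) a) C = coeff (app (- (pd j * pd i)) a) C"
    by (cases "i = j") (simp_all add: coeff_pd * insert_commute)
qed

lemma pd_square [simp]: "pd i * pd i = 0"
  by (rule gend_eqI, rule grassmann_eqI) (simp add: coeff_pd)


section \<open>Relations between the pivot elements\<close>

text \<open>Pivots are only pointwise limits. An identity that evaluates a pivot at finitely many
  arguments can be proved for one truncation that is exact at all of them.\<close>

lemma pivot_trunc_agree:
  assumes "finite F"
  obtains n where "\<And>a. a \<in> F \<Longrightarrow> app (pivot i) a = app (pivot_trunc n i) a"
proof -
  have "\<forall>\<^sub>F n in sequentially. \<forall>a\<in>F. app (pivot i) a = app (pivot_trunc n i) a"
    using assms pivot_limit by (intro eventually_ball_finite) auto
  then show thesis using that by (auto simp: eventually_sequentially)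
qed

lemma odd_superderivation_pivot_trunc: "odd_superderivation (pivot_trunc n i)"
proof (induction n arbitrary: i)
  case 0 then show ?case by (simp add: odd_superderivation_zero)
next
  case (Suc n)
  have "gen i * gen (i + 1) \<in> gdeg 2"
    using gdeg_mult[OF gen_gdeg gen_gdeg, of i "i + 1"] by (simp add: numeral_2_eq_2)
  from odd_superderivation_add[OF odd_superderivation_pd odd_superderivation_even_mult[OF Suc this]]
  show ?case by (simp add: mul_x_def lmult_mult)
qed

lemma odd_superderivation_pivot: "odd_superderivation (pivot i :: 'k::field gend)"
  unfolding odd_superderivation_def
proof (intro conjI allI ballI)
  note T = odd_superderivation_pivot_trunc[unfolded odd_superderivation_def]
  show "(pivot i :: 'k gend) \<in> edeg 1"
    unfolding edeg_def
  proof (intro CollectI allI ballI)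
    fix d and a :: "'k grassmann" assume "a \<in> gdeg d"
    moreover obtain n where "app (pivot i) a = app (pivot_trunc n i) a"
      by (rule pivot_trunc_agree[of "{a}" i]) auto
    ultimately show "app (pivot i) a \<in> gdeg (d + 1)" using T[of n i, where 'a = 'k] by (auto simp: edeg_def)
  qed
  fix d and a b :: "'k grassmann" assume "a \<in> gdeg d"
  moreover obtain n where "\<And>c. c \<in> {a, b, a * b} \<Longrightarrow> app (pivot i) c = app (pivot_trunc n i) c"
    by (rule pivot_trunc_agree[of "{a, b, a * b}" i]) auto
  ultimately show "app (pivot i) (a * b) = app (pivot i) a * b + (-1) ^ d * a * app (pivot i) b"
    using T[of n i, where 'a = 'k] by simp
qed

text \<open>Every summand of v_i ends in some \<open>pd j\<close> with j >= i, and such a derivation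
  kills an element without the letter x_j.\<close>

lemma pivot_supported_below:
  assumes "a \<in> supported {..<i}"
  shows "app (pivot i) a = 0"
proof -
  have "app (pivot_trunc n i) a = 0" for n
    using assms
  proof (induction n arbitrary: i)
    case (Suc n)
    have "coeff a (insert i C) = 0" for C using Suc.prems by (auto simp: supported_def)
    then have "app (pd i) a = 0" by (intro grassmann_eqI) (simp add: coeff_pd)
    moreover have "app (pivot_trunc n (i + 2)) a = 0"
      by (intro Suc.IH supported_mono[OF Suc.prems]) auto
    ultimately show ?case by simp
  qed simp
  then show ?thesis by (metis finite.emptyI finite_insert insertI1 pivot_trunc_agree)
qed

lemma pivot_lmult_below:
  assumes "a \<in> supported {..<i}" "a \<in> gdeg d"
  shows "pivot i * lmult a = (-1) ^ d * (lmult a * pivot i)"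
  using odd_superderivation_lmult[OF odd_superderivation_pivot assms(2)] pivot_supported_below[OF assms(1)]
  by simp

lemma pivot_mul_x_below: "j < i \<Longrightarrow> pivot i * mul_x j = - (mul_x j * pivot i)"
  by (simp add: odd_superderivation_mul_x[OF odd_superderivation_pivot] pivot_supported_below supported_gen)

lemma app_pivot_rec:
  "app (pivot i) a = app (pd i) a + gen i * (gen (i + 1) * app (pivot (i + 2)) a)"
  by (subst pivot_rec) (simp add: mul_x_def)

lemma pivot_gen_self: "app (pivot i) (gen i) = 1"
  by (simp add: app_pivot_rec[of i] pd_gen pivot_supported_below supported_gen)

lemma pivot_mul_x_self: "pivot i * mul_x i = 1 - mul_x i * pivot i"
  by (simp add: odd_superderivation_mul_x[OF odd_superderivation_pivot] pivot_gen_self)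

lemma pivot_pd_below:
  assumes "j < i"
  shows "pivot i * pd j = - (pd j * pivot i :: 'k::field gend)"
proof -
  have trunc: "pivot_trunc n i * pd j = - (pd j * pivot_trunc n i :: 'k gend)" for n
    using assms
  proof (induction n arbitrary: i)
    case (Suc n)
    let ?T = "pivot_trunc n (i + 2) :: 'k gend"
    have T: "?T * pd j = - (pd j * ?T)" by (rule Suc.IH) (use Suc.prems in simp)
    have x: "pd j * (mul_x i * T) = - (mul_x i * (pd j * T))"
         "pd j * (mul_x (i + 1) * T) = - (mul_x (i + 1) * (pd j * T))" for T :: "'k gend"
      using Suc.prems pd_mul_x[of j i, where 'a = 'k] pd_mul_x[of j "i + 1", where 'a = 'k]
      by (simp_all add: mult.assoc[symmetric])
    show ?case
      by (simp add: distrib_left distrib_right mult.assoc T x pd_anticommute[of i j]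
          del: One_nat_def add_2_eq_Suc add_2_eq_Suc' add_Suc_right)
  qed simp
  show ?thesis
  proof (rule gend_eqI)
    fix a :: "'k grassmann"
    \<comment> \<open>The two sides evaluate v_i at \<open>a\<close> and at its derivative, so one
      truncation must be exact at both.\<close>
    obtain n where "\<And>c. c \<in> {a, app (pd j) a} \<Longrightarrow> app (pivot i) c = app (pivot_trunc n i) c"
      by (rule pivot_trunc_agree[of "{a, app (pd j) a}" i]) auto
    then show "app (pivot i * pd j) a = app (- (pd j * pivot i)) a"
      using arg_cong[OF trunc[of n], of "\<lambda>T. app T a"] by simp
  qed
qed

text \<open>The supercommutator of two odd operators. All pivots are odd, so relations among them
  can be computed in a plain ring.\<close>

definition anticommutator :: "'a::ring_1 \<Rightarrow> 'a \<Rightarrow> 'a" where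
  "anticommutator S T = S * T + T * S"

text \<open>Abstract computation of v_i * v_i, with p, x, y, w standing for \<open>pd i\<close>,
  x_i, x_{i+1}, v_{i+2}. The square of \<open>x * y * w\<close> repeats x and vanishes; the two
  mixed products cancel up to the term produced by the constant 1 in
  \<open>p * x = 1 - x * p\<close>.\<close>

lemma square_clifford:
  fixes p w x y :: "'a::ring_1"
  assumes "p * p = 0" "x * x = 0" "y * x = - (x * y)"
    and px: "p * x = 1 - x * p" and py: "p * y = - (y * p)"
    and wp: "w * p = - (p * w)" and wx: "w * x = - (x * w)" and wy: "w * y = - (y * w)"
  shows "(p + x * y * w) * (p + x * y * w) = y * w"
proof -
  have 1: "p * (x * y * w) = y * w + x * y * (p * w)"
  proof -
    have "p * (x * y * w) = (p * x) * (y * w)" by (simp add: mult.assoc)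
    also have "\<dots> = y * w - x * ((p * y) * w)" unfolding px by (simp add: algebra_simps)
    also have "\<dots> = y * w + x * y * (p * w)" unfolding py by (simp add: algebra_simps)
    finally show ?thesis .
  qed
  have 2: "x * y * w * p = - (x * y * (p * w))"
    using wp by (simp add: mult.assoc)
  have "x * y * w * (x * y * w) = x * y * (w * x) * y * w" by (simp add: mult.assoc)
  also have "\<dots> = - (x * (y * x) * w * y * w)" unfolding wx by (simp add: mult.assoc)
  also have "\<dots> = x * x * y * w * y * w" unfolding assms(3) by (simp add: mult.assoc)
  finally have 3: "x * y * w * (x * y * w) = 0" using assms(2) by simp
  show ?thesis using assms(1) by (simp add: distrib_left distrib_right 1 2 3)
qed

lemma pivot_square: "pivot i * pivot i = mul_x (i + 1) * pivot (i + 2)"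
proof -
  have "(pd i + mul_x i * mul_x (i + 1) * pivot (i + 2)) * (pd i + mul_x i * mul_x (i + 1) * pivot (i + 2))
      = mul_x (i + 1) * (pivot (i + 2) :: 'a gend)"
    by (intro square_clifford pd_square mul_x_square mul_x_anticommute pivot_pd_below pivot_mul_x_below)
      (simp_all add: pd_mul_x)
  then show ?thesis by (simp only: pivot_rec[symmetric])
qed

lemma pivot_anticommutator_Suc:
  "anticommutator (pivot i) (pivot (i + 1)) = - (mul_x i * pivot (i + 2) :: 'k::field gend)"
proof -
  let ?x = "mul_x i :: 'k gend" and ?y = "mul_x (i + 1) :: 'k gend" and ?p = "pd (i + 1) :: 'k gend"
  let ?u = "pivot (i + 1) :: 'k gend" and ?w = "pivot (i + 2) :: 'k gend"
  \<comment> \<open>Left multiplication by x_{i+1} reduces v_{i+1} to \<open>pd (i + 1)\<close>,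
    which, unlike v_{i+1}, anticommutes with v_{i+2}.\<close>
  have yu: "?y * ?u = ?y * ?p"
    by (subst pivot_rec) (simp add: distrib_left mult.assoc[symmetric])
  have wy: "?w * ?y = - (?y * ?w)" by (rule pivot_mul_x_below) simp
  have wp: "?w * ?p = - (?p * ?w)" by (rule pivot_pd_below) simp
  have "?y * (?w * ?u) = - (?w * ?y * ?u)" unfolding wy by (simp add: mult.assoc)
  also have "\<dots> = - (?w * (?y * ?p))" by (simp only: yu mult.assoc)
  also have "\<dots> = - (?w * ?y * ?p)" by (simp add: mult.assoc)
  also have "\<dots> = - (?y * ?p * ?w)" unfolding wy by (simp add: mult.assoc wp[simplified])
  finally have y: "?y * (?w * ?u) = - (?y * (?u * ?w))"
    using yu by (simp add: mult.assoc[symmetric])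
  have ux: "?u * ?x = - (?x * ?u)" by (rule pivot_mul_x_below) simp
  \<comment> \<open>The constant 1 is the source of the surviving term - x_i v_{i+2}.\<close>
  have uy: "?u * ?y = 1 - ?y * ?u" by (rule pivot_mul_x_self)
  have up: "?u * pd i = - (pd i * ?u)" by (rule pivot_pd_below) simp
  have "?u * (?x * ?y * ?w) = (?u * ?x) * ?y * ?w" by (simp add: mult.assoc)
  also have "\<dots> = - (?x * (?u * ?y) * ?w)" unfolding ux by (simp add: mult.assoc)
  also have "\<dots> = ?x * (?y * (?u * ?w)) - ?x * ?w" unfolding uy by (simp add: algebra_simps)
  finally have u: "?u * (?x * ?y * ?w) = ?x * (?y * (?u * ?w)) - ?x * ?w" .
  have "?x * ?y * ?w * ?u = - (?x * (?y * (?u * ?w)))" using y by (simp add: mult.assoc)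
  then have "(pd i + ?x * ?y * ?w) * ?u + ?u * (pd i + ?x * ?y * ?w) = - (?x * ?w)"
    unfolding distrib_left distrib_right u up by simp
  then show ?thesis by (simp only: anticommutator_def pivot_rec[of i, symmetric])
qed

text \<open>In v_i = pd_i + x_i x_{i+1} v_{i+2} the first summand anticommutes with v_m, while the
  even factor x_i x_{i+1} has only letters below m and hence commutes with v_m.\<close>

lemma pivot_anticommutator_step:
  assumes "i + 2 \<le> m"
  shows "anticommutator (pivot i) (pivot m) = lmult (gen i * gen (i + 1)) * anticommutator (pivot (i + 2)) (pivot m)"
proof -
  let ?e = "gen i * gen (i + 1) :: 'a grassmann" and ?w = "pivot (i + 2) :: 'a gend" and ?v = "pivot m :: 'a gend"
  have "?e \<in> supported {..<m}" using assms by (intro supported_mult supported_gen) auto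
  moreover have "?e \<in> gdeg 2" using gdeg_mult[OF gen_gdeg gen_gdeg, of i "i + 1"] by (simp add: numeral_2_eq_2)
  ultimately have e: "?v * lmult ?e = lmult ?e * ?v" using pivot_lmult_below by fastforce
  have p: "?v * pd i = - (pd i * ?v)" using assms by (intro pivot_pd_below) simp
  have "?v * (lmult ?e * ?w) = lmult ?e * (?v * ?w)" using e by (simp add: mult.assoc[symmetric])
  then have "(pd i + lmult ?e * ?w) * ?v + ?v * (pd i + lmult ?e * ?w) = lmult ?e * (?w * ?v + ?v * ?w)"
    unfolding distrib_left distrib_right p by (simp add: mult.assoc)
  then show ?thesis
    unfolding anticommutator_def lmult_mult mul_x_def[symmetric] by (simp only: pivot_rec[of i, symmetric])
qed

text \<open>Raising n by 2 repeatedly ends at m or at m - 1, which are the two cases. The parity is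
  recorded in the first case because it rules out n = 0, m = 1 there; this is what protects the
  excluded monomial with head v_3.\<close>

lemma pivot_anticommutator:
  assumes "n \<le> m"
  obtains (even) h where "even (m - n)" "h \<in> supported {n..<m}"
      "anticommutator (pivot n) (pivot m) = lmult (h * gen (m + 1)) * (pivot (m + 2) :: 'k::field gend)"
    | (odd) h where "n < m" "h \<in> supported {n..<m}"
      "anticommutator (pivot n) (pivot m) = lmult h * (pivot (m + 1) :: 'k::field gend)"
proof -
  let ?E = "\<lambda>n. \<exists>h. even (m - n) \<and> h \<in> supported {n..<m} \<and>
      anticommutator (pivot n) (pivot m) = lmult (h * gen (m + 1)) * (pivot (m + 2) :: 'k gend)"
  let ?O = "\<lambda>n. \<exists>h. n < m \<and> h \<in> supported {n..<m} \<and>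
      anticommutator (pivot n) (pivot m) = lmult h * (pivot (m + 1) :: 'k gend)"
  have "?E n \<or> ?O n"
    using assms
  proof (induction "m - n" arbitrary: n rule: less_induct)
    case less
    consider "m = n" | "m = n + 1" | "n + 2 \<le> m" using less.prems by linarith
    then show ?case
    proof cases
      case 1
      \<comment> \<open>The coefficient 2 of the square is absorbed into h as 1 + 1.\<close>
      have "anticommutator (pivot m) (pivot m) = lmult ((1 + 1) * gen (m + 1)) * (pivot (m + 2) :: 'k gend)"
        by (simp only: anticommutator_def pivot_square mul_x_def distrib_right lmult_add mult_1_left)
      moreover have "1 + 1 \<in> (supported {n..<m} :: 'k grassmann set)" by (intro supported_add supported_one)
      moreover have "even (m - n)" using 1 by simp
      ultimately show ?thesis using 1 by blast
    next
      case 2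
      have "anticommutator (pivot n) (pivot m) = lmult (- gen n) * (pivot (m + 1) :: 'k gend)"
        using pivot_anticommutator_Suc[of n, where 'k = 'k] 2 by (simp add: lmult_minus mul_x_def)
      moreover have "- gen n \<in> (supported {n..<m} :: 'k grassmann set)"
        using 2 supported_gscale[OF supported_gen, of n "{n..<m}" "-1 :: 'k"] by simp
      ultimately show ?thesis using 2 by (intro disjI2 exI[of _ "- gen n"]) auto
    next
      case 3
      let ?e = "gen n * gen (n + 1) :: 'k grassmann"
      have sup: "?e * h \<in> supported {n..<m}" if "h \<in> supported {n + 2..<m}" for h
        using 3 by (intro supported_mult supported_gen supported_mono[OF that]) auto
      have "?E (n + 2) \<or> ?O (n + 2)" using 3 by (intro less.hyps) auto
      then show ?thesis
      proof
        assume "?E (n + 2)"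
        then obtain h where h: "even (m - (n + 2))" "h \<in> supported {n + 2..<m}"
          "anticommutator (pivot (n + 2)) (pivot m) = lmult (h * gen (m + 1)) * (pivot (m + 2) :: 'k gend)" by blast
        have "even (m - n)" using h(1) 3 by presburger
        then show ?thesis using sup[OF h(2)]
          by (intro disjI1 exI[of _ "?e * h"])
            (simp add: pivot_anticommutator_step[OF 3] h(3)[simplified] lmult_mult mult.assoc)
      next
        assume "?O (n + 2)"
        then obtain h where h: "n + 2 < m" "h \<in> supported {n + 2..<m}"
          "anticommutator (pivot (n + 2)) (pivot m) = lmult h * (pivot (m + 1) :: 'k gend)" by blast
        then show ?thesis using sup[OF h(2)]
          by (intro disjI2 exI[of _ "?e * h"])
            (simp add: pivot_anticommutator_step[OF 3] lmult_mult mult.assoc)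
      qed
    qed
  qed
  then show thesis using even odd by blast
qed

section \<open>Letters occurring in the values of pivots\<close>

lemma supported_pd:
  assumes "a \<in> supported B"
  shows "app (pd i) a \<in> supported B"
  using assms by (auto simp: supported_def coeff_pd split: if_splits)

lemma pivot_supported:
  assumes "a \<in> supported {..<k}"
  shows "app (pivot n) a \<in> supported {..<k}"
proof (induction "k - n" arbitrary: n rule: less_induct)
  case less
  show ?case
  proof (cases "n < k")
    case False
    then have "a \<in> supported {..<n}" using supported_mono[OF assms] by auto
    then show ?thesis by (simp add: pivot_supported_below)
  next
    case True
    have "gen n * (gen (n + 1) * app (pivot (n + 2)) a) \<in> supported {..<k}"
    proof (cases "n + 1 < k")
      case True
      then show ?thesis by (intro supported_mult supported_gen less.hyps) auto
    next
      \<comment> \<open>Here n = k - 1, so x_{n+1} = x_k would leave the range, but v_{n+2} already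
        kills \<open>a\<close>.\<close>
      case False
      then have "a \<in> supported {..<n + 2}" using supported_mono[OF assms] by auto
      then show ?thesis by (simp add: pivot_supported_below)
    qed
    then show ?thesis
      by (subst app_pivot_rec) (intro supported_add supported_pd assms)
  qed
qed

text \<open>Among the derivations in v_n only \<open>pd k\<close> does not kill x_k, and the letters
  in front of it in the nested sum have index below k.\<close>

lemma pivot_gen_supported: "app (pivot n) (gen k :: 'k::field grassmann) \<in> supported {..<k}"
proof (induction "k - n" arbitrary: n rule: less_induct)
  case less
  consider "k < n + 2" | "n + 2 \<le> k" by linarith
  then show ?case
  proof cases
    case 1
    then show ?thesis by (subst app_pivot_rec) (simp add: pd_gen pivot_supported_below supported_gen)
  next
    case 2
    then have "gen n * (gen (n + 1) * app (pivot (n + 2)) (gen k :: 'k grassmann)) \<in> supported {..<k}"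
      by (intro supported_mult supported_gen less.hyps) auto
    moreover have "app (pd n) (gen k :: 'k grassmann) = 0" using 2 by (simp add: pd_gen)
    ultimately show ?thesis by (subst app_pivot_rec) simp
  qed
qed


section \<open>Brackets of standard monomials\<close>

lemma lmult_edeg: "a \<in> gdeg p \<Longrightarrow> lmult a \<in> edeg p"
  using gdeg_mult by (fastforce simp: edeg_def add.commute)

lemma edeg_mult: "S \<in> edeg s \<Longrightarrow> T \<in> edeg t \<Longrightarrow> S * T \<in> edeg (s + t)"
  by (fastforce simp: edeg_def add_ac)

lemma lmult_pivot_edeg:
  assumes "a \<in> gdeg p"
  shows "lmult a * pivot n \<in> edeg (p + 1)"
  using odd_superderivation_pivot unfolding odd_superderivation_def
  by (intro edeg_mult lmult_edeg assms) blast

text \<open>Moving v_m past f costs (-1)^p and moving g past f costs (-1)^(p q). Together with the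
  sign (-1)^((p+1)(q+1)) of the bracket this leaves -(-1)^q, so the two products of pivots appear
  with equal signs and form the anticommutator.\<close>

lemma bracket_formula:
  fixes f g :: "'k::field grassmann"
  assumes f: "f \<in> gdeg p" "f \<in> supported {..<n}" and g: "g \<in> gdeg q" and "n \<le> m"
  shows "supercommutator (lmult f * pivot n) (lmult g * pivot m) =
    lmult (f * app (pivot n) g) * pivot m + (-1) ^ q * (lmult (f * g) * anticommutator (pivot n) (pivot m))"
proof -
  let ?u = "pivot n :: 'k gend" and ?v = "pivot m :: 'k gend" and ?F = "lmult f" and ?G = "lmult g"
  have fm: "f \<in> supported {..<m}" using supported_mono[OF f(2)] assms(4) by auto
  have u: "?u * ?G = lmult (app ?u g) + escale ((-1) ^ q) (?G * ?u)"
    using odd_superderivation_lmult[OF odd_superderivation_pivot g] by (simp add: minus_one_power_escale)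
  have v: "?v * ?F = escale ((-1) ^ p) (?F * ?v)"
    using pivot_lmult_below[OF fm f(1)] by (simp add: minus_one_power_escale)
  have GF: "?G * ?F = escale ((-1) ^ (p * q)) (?F * ?G)"
    using graded_commute[OF f(1) g] by (simp add: lmult_mult[symmetric] minus_one_power_mult lmult_gscale[symmetric])
  have 1: "?F * ?u * (?G * ?v) = lmult (f * app ?u g) * ?v + escale ((-1) ^ q) (?F * ?G * (?u * ?v))"
  proof -
    have "?F * ?u * (?G * ?v) = ?F * (?u * ?G) * ?v" by (simp add: mult.assoc)
    then show ?thesis unfolding u
      by (simp add: distrib_left distrib_right lmult_mult escale_mult_left escale_mult_right mult.assoc)
  qed
  have 2: "?G * ?v * (?F * ?u) = escale ((-1) ^ (p * q) * (-1) ^ p) (?F * ?G * (?v * ?u))"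
  proof -
    have "?G * ?v * (?F * ?u) = ?G * (?v * ?F) * ?u" by (simp add: mult.assoc)
    also have "\<dots> = escale ((-1) ^ p) ((?G * ?F) * (?v * ?u))"
      unfolding v by (simp add: escale_mult_left escale_mult_right mult.assoc)
    finally show ?thesis unfolding GF by (simp add: escale_mult_left mult.commute)
  qed
  have sign: "(-1) ^ ((p + 1) * (q + 1)) * ((-1) ^ (p * q) * (-1) ^ p) = (- ((-1) ^ q) :: 'k)"
    by (simp add: minus_one_power_iff)
  have "supercommutator (?F * ?u) (?G * ?v) =
      ?F * ?u * (?G * ?v) - escale ((-1) ^ ((p + 1) * (q + 1))) (?G * ?v * (?F * ?u))"
    unfolding minus_one_power_escale[symmetric]
    by (rule supercommutator_homogeneous) (intro lmult_pivot_edeg f g)+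
  also have "\<dots> = lmult (f * app ?u g) * ?v + escale ((-1) ^ q) (?F * ?G * (?u * ?v))
      + escale ((-1) ^ q) (?F * ?G * (?v * ?u))"
    unfolding 1 2 End.scale_scale sign by simp
  finally show ?thesis
    by (simp add: anticommutator_def minus_one_power_escale lmult_mult distrib_left
        End.scale_right_distrib add.assoc)
qed

section \<open>Skew symmetry and bilinearity of the supercommutator\<close>

lemma supercommutator_skew:
  assumes "S \<in> edeg s" "T \<in> edeg t"
  shows "supercommutator T S = escale (- ((-1) ^ (s * t))) (supercommutator S T)"
  using assms by (simp add: supercommutator_homogeneous minus_one_power_escale End.scale_right_diff_distrib
      mult.commute[of t] power_mult_distrib[symmetric])

lemma epart_add: "epart s (S + T) = epart s S + epart s T"
  by (simp add: epart_def distrib_left distrib_right)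

lemma epart_escale: "epart s (escale c S) = escale c (epart s S)"
  by (simp add: epart_def escale_mult_left escale_mult_right End.scale_right_distrib)

lemma epart_zero: "epart s 0 = 0"
  by (simp add: epart_def)

lemma supercommutator_add_left:
  "supercommutator (S + S') T = supercommutator S T + supercommutator S' T"
  by (simp add: supercommutator_def epart_add algebra_simps)

lemma supercommutator_add_right:
  "supercommutator S (T + T') = supercommutator S T + supercommutator S T'"
  by (simp add: supercommutator_def epart_add algebra_simps)

lemma supercommutator_escale_left: "supercommutator (escale c S) T = escale c (supercommutator S T)"
  by (simp add: supercommutator_def epart_escale escale_mult_left escale_mult_right
      End.scale_right_distrib End.scale_right_diff_distrib)

lemma supercommutator_escale_right: "supercommutator S (escale c T) = escale c (supercommutator S T)"
  by (simp add: supercommutator_def epart_escale escale_mult_left escale_mult_right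
      End.scale_right_distrib End.scale_right_diff_distrib)

lemma supercommutator_span_closed:
  assumes B: "\<And>S T. S \<in> B \<Longrightarrow> T \<in> B \<Longrightarrow> supercommutator S T \<in> End.span B"
    and "S \<in> End.span B" "T \<in> End.span B"
  shows "supercommutator S T \<in> End.span B"
proof -
  have zero: "supercommutator 0 T = 0" "supercommutator T 0 = 0" for T :: "'a gend"
    by (simp_all add: supercommutator_def epart_zero)
  have "supercommutator S T \<in> End.span B" if "S \<in> B" for S
    using assms(3)
  proof (induction T rule: End.span_induct_alt)
    case base show ?case by (simp add: zero End.span_zero)
  next
    case (step c T U)
    then show ?case using B[OF that]
      by (simp add: supercommutator_add_right supercommutator_escale_right End.span_add End.span_scale)
  qed
  with assms(2) show ?thesis
    by (induction S rule: End.span_induct_alt)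
      (simp_all add: zero supercommutator_add_left supercommutator_escale_left
        End.span_zero End.span_add End.span_scale)
qed


section \<open>The standard monomials\<close>

text \<open>
  The letters besides \<open>x\<^bsub>n-1\<^esub>\<close> of the second type monomials with head \<open>v\<^sub>n\<close>: the excluded
  \<open>x\<^sub>0 x\<^sub>2 v\<^sub>3\<close> is the only one that would have such a letter for \<open>n = 3\<close>.
\<close>

definition tail_set :: "nat \<Rightarrow> nat set" where
  "tail_set n = {i. i + 2 < n \<and> n \<noteq> 3}"

text \<open>Both types are encoded by the set of letters in front of the head v_n. For n = 0 and n =
  1 the truncated \<open>n - 1\<close> leaves only the empty set, matching r_m = 1 for negative
  m.\<close>

definition admissible :: "nat \<Rightarrow> nat set set" where
  "admissible n = {A. A \<subseteq> {..<n - 1} \<or> (2 \<le> n \<and> n - 1 \<in> A \<and> A - {n - 1} \<subseteq> tail_set n)}"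

definition standard_basis :: "'k::field gend set" where
  "standard_basis = {lmult (gmono A) * pivot n | A n. A \<in> admissible n}"

lemma admissible_lessThan: "A \<in> admissible n \<Longrightarrow> A \<subseteq> {..<n}"
  by (auto simp: admissible_def tail_set_def)

text \<open>Reduction to monomial coefficients. The right factor \<open>T\<close> is v_n for the
  first type and x_{n-1} v_n for the second.\<close>

lemma supported_span_mem:
  assumes a: "a \<in> supported B" and B: "\<And>A. A \<subseteq> B \<Longrightarrow> finite A \<Longrightarrow> lmult (gmono A) * T \<in> End.span S"
  shows "lmult a * T \<in> End.span S"
proof -
  have lsum: "lmult (sum h I) = (\<Sum>i\<in>I. lmult (h i))" for h :: "nat set \<Rightarrow> 'a grassmann" and I
    by (induction I rule: infinite_finite_induct) (simp_all add: lmult_add)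
  have "lmult a * T = lmult (\<Sum>A | coeff a A \<noteq> 0. gscale (coeff a A) (gmono A)) * T"
    by (simp only: grassmann_expansion[symmetric])
  also have "\<dots> = (\<Sum>A | coeff a A \<noteq> 0. escale (coeff a A) (lmult (gmono A) * T))"
    by (simp add: lsum sum_distrib_right lmult_gscale escale_mult_left)
  also have "\<dots> \<in> End.span S"
    using a by (intro End.span_sum End.span_scale B) (auto simp: supported_def coeff_nonzero_finite)
  finally show ?thesis .
qed

lemma first_type_span:
  assumes "a \<in> supported {..<n - 1}"
  shows "lmult a * pivot n \<in> End.span standard_basis"
  by (rule supported_span_mem[OF assms], rule End.span_base)
    (auto simp: standard_basis_def admissible_def)

lemma gmono_insert_pred:
  assumes "finite A" "A \<subseteq> tail_set n"
  shows "gmono (insert (n - 1) A) = gmono A * gen (n - 1)"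
  using assms by (intro gmono_insert_greatest) (auto simp: tail_set_def)

lemma second_type_span:
  fixes a :: "'k::field grassmann"
  assumes "2 \<le> n" "a \<in> supported (tail_set n)"
  shows "lmult (a * gen (n - 1)) * pivot n \<in> End.span standard_basis"
proof -
  have "lmult a * (lmult (gen (n - 1)) * pivot n) \<in> End.span standard_basis"
  proof (rule supported_span_mem[OF assms(2)], rule End.span_base)
    fix A assume A: "A \<subseteq> tail_set n" "finite A"
    have "n - 1 \<notin> tail_set n" using assms(1) by (auto simp: tail_set_def)
    then have "insert (n - 1) A \<in> admissible n" using A assms(1) by (auto simp: admissible_def)
    moreover have "lmult (gmono A) * (lmult (gen (n - 1)) * pivot n) = (lmult (gmono (insert (n - 1) A)) * pivot n :: 'k gend)"
      using gmono_insert_pred[OF A(2,1), where 'a = 'k] by (simp add: lmult_mult mult.assoc)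
    ultimately show "lmult (gmono A) * (lmult (gen (n - 1)) * pivot n) \<in> (standard_basis :: 'k gend set)"
      unfolding standard_basis_def by blast
  qed
  then show ?thesis by (simp add: lmult_mult mult.assoc)
qed

lemma admissible_cases:
  assumes "A \<in> admissible n"
  obtains (first) "A \<subseteq> {..<n - 1}"
    | (second) A' where "2 \<le> n" "A' \<subseteq> tail_set n" "gmono A = gmono A' * (gen (n - 1) :: 'k::field grassmann)"
proof (cases "A \<subseteq> {..<n - 1}")
  case False
  have "finite A" using admissible_lessThan[OF assms] finite_subset by blast
  moreover have "2 \<le> n" "insert (n - 1) (A - {n - 1}) = A" "A - {n - 1} \<subseteq> tail_set n"
    using assms False by (auto simp: admissible_def)
  ultimately show ?thesis using gmono_insert_pred[of "A - {n - 1}" n] second by (metis finite_Diff)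
qed (rule first)

text \<open>For a second type monomial r x_{m-1} v_m the Leibniz rule gives two terms: if v_n hits
  x_{m-1}, only letters below m - 1 remain and the head v_m is of first type; if v_n hits r, the
  letter x_{m-1} survives and the rest has to stay in the tail set.\<close>

lemma derivative_term_span:
  fixes f :: "'k::field grassmann"
  assumes f: "f \<in> supported {..<n}" and "n < m" "A \<in> admissible m"
  shows "lmult (f * app (pivot n) (gmono A)) * pivot m \<in> End.span standard_basis"
proof -
  have fm: "f \<in> supported {..<m - 1}" using assms(2) by (intro supported_mono[OF f]) auto
  show ?thesis
    using assms(3)
  proof (cases rule: admissible_cases[where 'k = 'k])
    case first
    then show ?thesis
      by (intro first_type_span supported_mult fm pivot_supported supported_gmono)
  next
    case (second A')
    let ?r = "gmono A' :: 'k grassmann" and ?x = "gen (m - 1) :: 'k grassmann"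
    have A': "A' \<subseteq> {..<m - 2}" using second(2) by (auto simp: tail_set_def)
    have "app (pivot n) (?r * ?x) = app (pivot n) ?r * ?x + (-1) ^ card A' * ?r * app (pivot n) ?x"
      using odd_superderivation_pivot gmono_gdeg unfolding odd_superderivation_def by blast
    then have eq: "f * app (pivot n) (?r * ?x) =
        f * app (pivot n) ?r * ?x + gscale ((-1) ^ card A') (f * (?r * app (pivot n) ?x))"
      by (simp add: minus_one_power_mult distrib_left gscale_mult_left gscale_mult_right mult.assoc)
    have "f * (?r * app (pivot n) ?x) \<in> supported {..<m - 1}"
      using A' by (intro supported_mult fm pivot_gen_supported supported_gmono) auto
    then have "lmult (gscale ((-1) ^ card A') (f * (?r * app (pivot n) ?x))) * pivot m \<in> End.span standard_basis"
      by (intro first_type_span supported_gscale)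
    moreover have "f * app (pivot n) ?r \<in> supported (tail_set m)"
    \<comment> \<open>These are the cases where f may contain a letter outside the tail set: x_{m-2}
      if m = n + 1, any letter if m = 3. In both v_n kills r, whose letters lie below n in the first
      case and which is 1 in the second.\<close>
    proof (cases "m = n + 1 \<or> m = 3")
      case True
      have "app (pivot n) ?r = 0"
      proof (cases "m = 3")
        case True
        then have "A' = {}" using second(2) by (auto simp: tail_set_def)
        then show ?thesis by (simp add: odd_superderivation_one odd_superderivation_pivot)
      next
        case False
        with True A' show ?thesis
          by (intro pivot_supported_below supported_gmono) auto
      qed
      then show ?thesis by simp
    next
      case False
      then have "tail_set m = {..<m - 2}" by (auto simp: tail_set_def)
      moreover have "f \<in> supported {..<m - 2}" using False assms(2) by (intro supported_mono[OF f]) auto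
      ultimately show ?thesis
        using A' by (simp add: supported_mult pivot_supported supported_gmono)
    qed
    then have "lmult (f * app (pivot n) ?r * ?x) * pivot m \<in> End.span standard_basis"
      by (rule second_type_span[OF second(1)])
    ultimately show ?thesis
      unfolding second(3) eq lmult_add distrib_right by (intro End.span_add)
  qed
qed

text \<open>The support conditions say that a coefficient of v_1 is a scalar, as it is for
  admissible sets. This matters for the head v_{m+2} with m = 1, where the tail set is
  empty.\<close>

lemma anticommutator_term_span:
  fixes f g :: "'k::field grassmann"
  assumes "n \<le> m" and f: "f \<in> supported {i. i < n \<and> n \<noteq> 1}" and g: "g \<in> supported {i. i < m \<and> m \<noteq> 1}"
  shows "lmult (f * g) * anticommutator (pivot n) (pivot m) \<in> End.span standard_basis"
  using assms(1)
proof (cases rule: pivot_anticommutator[where 'k = 'k])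
  case (even h)
  \<comment> \<open>By parity n = 0 is impossible for m = 1, so h has no letters either.\<close>
  have "m = 1 \<longrightarrow> n = 1" using even(1) assms(1) by (cases n) auto
  then have "f * g * h \<in> supported (tail_set (m + 2))"
    using assms(1) by (intro supported_mult supported_mono[OF f] supported_mono[OF g] supported_mono[OF even(2)])
      (auto simp: tail_set_def)
  then show ?thesis using second_type_span[of "m + 2" "f * g * h"]
    by (simp add: even(3)[simplified] lmult_mult mult.assoc)
next
  case (odd h)
  have "f * g * h \<in> supported {..<m + 1 - 1}"
    using assms(1) by (intro supported_mult supported_mono[OF f] supported_mono[OF g] supported_mono[OF odd(2)]) auto
  from first_type_span[OF this] show ?thesis
    by (simp add: odd(3)[simplified] lmult_mult mult.assoc)
qed

lemma supercommutator_standard_basis: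
  fixes S T :: "'k::field gend"
  assumes "S \<in> standard_basis" "T \<in> standard_basis"
  shows "supercommutator S T \<in> End.span standard_basis"
proof -
  have ordered: "supercommutator (lmult (gmono A) * pivot n) (lmult (gmono B) * pivot m :: 'k gend)
      \<in> End.span standard_basis"
    if A: "A \<in> admissible n" and B: "B \<in> admissible m" and "n \<le> m" for A B n m
  proof -
    have sup: "gmono C \<in> supported {i. i < k \<and> k \<noteq> 1}" if "C \<in> admissible k" for C k
      using that by (intro supported_gmono) (auto simp: admissible_def tail_set_def)
    have A': "gmono A \<in> supported {..<n}" by (intro supported_gmono admissible_lessThan A)
    have "lmult (gmono A * app (pivot n) (gmono B)) * pivot m \<in> End.span (standard_basis :: 'k gend set)"
    proof (cases "n = m")
      case True
      then have "app (pivot n) (gmono B :: 'k grassmann) = 0"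
        using B by (intro pivot_supported_below supported_gmono admissible_lessThan) simp
      then show ?thesis by (simp add: End.span_zero)
    next
      case False
      with that show ?thesis by (intro derivative_term_span A') auto
    qed
    moreover have "lmult (gmono A * gmono B) * anticommutator (pivot n) (pivot m) \<in> End.span (standard_basis :: 'k gend set)"
      by (intro anticommutator_term_span sup that)
    ultimately show ?thesis
      unfolding bracket_formula[OF gmono_gdeg A' gmono_gdeg \<open>n \<le> m\<close>] minus_one_power_escale
      by (intro End.span_add End.span_scale)
  qed
  obtain A n where S: "S = lmult (gmono A) * pivot n" "A \<in> admissible n"
    using assms(1) by (auto simp: standard_basis_def)
  obtain B m where T: "T = lmult (gmono B) * pivot m" "B \<in> admissible m"
    using assms(2) by (auto simp: standard_basis_def)
  show ?thesis
  proof (cases "n \<le> m")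
    case True
    with S T show ?thesis by (simp add: ordered)
  next
    \<comment> \<open>The bracket formula needs the smaller head on the left; skew symmetry covers
      the other order.\<close>
    case False
    then have "supercommutator T S \<in> End.span standard_basis" using S T by (simp add: ordered)
    moreover have "supercommutator S T =
        escale (- ((-1) ^ ((card B + 1) * (card A + 1)))) (supercommutator T S)"
      unfolding S(1) T(1) by (intro supercommutator_skew lmult_pivot_edeg gmono_gdeg)
    ultimately show ?thesis using End.span_scale by metis
  qed
qed

lemma lie_R_subset_span: "lie_R \<subseteq> End.span (standard_basis :: 'k::field gend set)"
proof -
  have "lmult (gmono {}) * pivot n \<in> (standard_basis :: 'k gend set)" for n
    unfolding standard_basis_def by (auto simp: admissible_def simp del: gmono_empty)
  then have "{pivot 0, pivot 1} \<subseteq> End.span (standard_basis :: 'k gend set)"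
    using End.span_base by (fastforce simp del: One_nat_def)
  moreover have "\<forall>S\<in>End.span (standard_basis :: 'k gend set). \<forall>T\<in>End.span standard_basis.
      supercommutator S T \<in> End.span standard_basis"
    using supercommutator_span_closed supercommutator_standard_basis by blast
  ultimately show ?thesis
    unfolding lie_R_def lie_superalgebra_def by (intro Inter_lower) (simp add: End.subspace_span)
qed

section \<open>Every standard monomial lies in R\<close>

lemma lie_R_subspace: "End.subspace lie_R"
  unfolding lie_R_def lie_superalgebra_def by (rule End.subspace_Inter) auto

lemma lie_R_generators: "pivot 0 \<in> lie_R" "pivot 1 \<in> lie_R"
  unfolding lie_R_def lie_superalgebra_def by auto

lemma lie_R_supercommutator: "S \<in> lie_R \<Longrightarrow> T \<in> lie_R \<Longrightarrow> supercommutator S T \<in> lie_R"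
  unfolding lie_R_def lie_superalgebra_def by auto

lemma lie_R_escale_iff: "c \<noteq> 0 \<Longrightarrow> escale c T \<in> lie_R \<longleftrightarrow> T \<in> lie_R"
  using End.subspace_scale[OF lie_R_subspace, of T c]
    End.subspace_scale[OF lie_R_subspace, of "escale c T" "inverse c"] by auto

text \<open>Since v_n(g) = 0, the derivative term of \<open>bracket_formula\<close> disappears and
  the bracket is the anticommutator term up to sign.\<close>

lemma lie_R_anticommutator:
  fixes f g :: "'k::field grassmann"
  assumes f: "f \<in> gdeg p" "f \<in> supported {..<n}" "lmult f * pivot n \<in> lie_R"
    and g: "g \<in> gdeg q" "app (pivot n) g = 0" "lmult g * pivot m \<in> lie_R" and "n \<le> m"
  shows "lmult (f * g) * anticommutator (pivot n) (pivot m) \<in> lie_R"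
proof -
  have "escale ((-1) ^ q) (lmult (f * g) * anticommutator (pivot n) (pivot m)) \<in> lie_R"
    using lie_R_supercommutator[OF f(3) g(3)] bracket_formula[OF f(1,2) g(1) \<open>n \<le> m\<close>] g(2)
    by (simp add: minus_one_power_escale)
  then show ?thesis by (simp add: lie_R_escale_iff)
qed

lemma first_type_lie_R:
  "A \<subseteq> {..<n - 1} \<Longrightarrow> lmult (gmono A :: 'k::field grassmann) * pivot n \<in> lie_R"
proof (induction n arbitrary: A rule: less_induct)
  case (less n)
  consider "n = 0" | "n = 1" | k where "n = k + 2" by (cases n; cases "n - 1") auto
  then show ?case
  proof cases
    case 1
    with less.prems lie_R_generators show ?thesis by simp
  next
    case 2
    with less.prems lie_R_generators show ?thesis by simp
  next
    case (3 k)
    have pk: "lmult (1 :: 'k grassmann) * pivot k \<in> lie_R" using less.IH[of k "{}"] 3 by simp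
    have deg: "(1 :: 'k grassmann) \<in> gdeg 0" using gmono_gdeg[of "{}"] by simp
    \<comment> \<open>Bracketing v_k with the first type monomial on B with head v_{k+1} appends x_k
      and raises the head to v_{k+2}.\<close>
    have with_k: "lmult (gmono B * gen k :: 'k grassmann) * pivot (k + 2) \<in> lie_R" if "B \<subseteq> {..<k}" for B
    proof -
      have "lmult (1 * gmono B :: 'k grassmann) * anticommutator (pivot k) (pivot (k + 1)) \<in> lie_R"
      proof (rule lie_R_anticommutator[OF deg _ pk gmono_gdeg])
        show "app (pivot k) (gmono B :: 'k grassmann) = 0" by (intro pivot_supported_below supported_gmono that)
        show "lmult (gmono B :: 'k grassmann) * pivot (k + 1) \<in> lie_R" using less.IH[of "k + 1" B] 3 that by simp
      qed simp_all
      then have "escale (-1) (lmult (gmono B * gen k :: 'k grassmann) * pivot (k + 2)) \<in> lie_R"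
        unfolding pivot_anticommutator_Suc by (simp add: lmult_mult mul_x_def mult.assoc)
      then show ?thesis by (subst (asm) lie_R_escale_iff) auto
    qed
    show ?thesis
    proof (cases "k \<in> A")
      case True
      have "A - {k} \<subseteq> {..<k}" using less.prems 3 by (auto simp: less_Suc_eq)
      moreover from this have "gmono (insert k (A - {k})) = gmono (A - {k}) * (gen k :: 'k grassmann)"
        by (intro gmono_insert_greatest finite_subset[of "A - {k}" "{..<k}"]) auto
      ultimately show ?thesis using with_k[of "A - {k}"] True 3 by (simp add: insert_absorb)
    next
      case False
      then have A: "A \<subseteq> {..<k}" using less.prems 3 by (auto simp: less_Suc_eq)
      \<comment> \<open>A monomial without x_k comes from the one with x_k already obtained: a
        further bracket with v_k differentiates x_k away.\<close>
      let ?g = "gmono A * gen k :: 'k grassmann"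
      have "lmult (1 * ?g) * anticommutator (pivot k) (pivot (k + 2))
          = lmult (?g * (gen k * gen (k + 1))) * anticommutator (pivot (k + 2)) (pivot (k + 2))"
        using pivot_anticommutator_step[of k "k + 2", where 'a = 'k] by (simp add: lmult_mult mult.assoc)
      also have "?g * (gen k * gen (k + 1)) = gmono A * (gen k * gen k) * gen (k + 1)"
        by (simp only: mult.assoc)
      \<comment> \<open>[v_k, v_{k+2}] starts with x_k x_{k+1}, and \<open>?g\<close> already
        contains x_k.\<close>
      finally have zero: "lmult (1 * ?g) * anticommutator (pivot k) (pivot (k + 2)) = 0" by simp
      have "app (pivot k) ?g = app (pivot k) (gmono A) * gen k + (-1) ^ card A * gmono A * app (pivot k) (gen k)"
        using odd_superderivation_pivot gmono_gdeg unfolding odd_superderivation_def by blast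
      then have der: "app (pivot k) ?g = gscale ((-1) ^ card A) (gmono A)"
        using A by (simp add: pivot_gen_self pivot_supported_below supported_gmono minus_one_power_mult)
      have "supercommutator (lmult 1 * pivot k) (lmult ?g * pivot (k + 2)) \<in> lie_R"
        by (intro lie_R_supercommutator pk with_k A)
      moreover have "supercommutator (lmult 1 * pivot k) (lmult ?g * pivot (k + 2))
          = lmult (1 * app (pivot k) ?g) * pivot (k + 2) + (-1) ^ (card A + 1) *
            (lmult (1 * ?g) * anticommutator (pivot k) (pivot (k + 2)))"
        by (intro bracket_formula[OF deg] gdeg_mult gmono_gdeg gen_gdeg) auto
      ultimately have "escale ((-1) ^ card A) (lmult (gmono A :: 'k grassmann) * pivot (k + 2)) \<in> lie_R"
        unfolding zero der by (simp add: lmult_gscale escale_mult_left)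
      then show ?thesis using 3 by (simp add: lie_R_escale_iff)
    qed
  qed
qed

text \<open>With n = k + 2, the source is [f v_k, g v_k], whose pivot part is [v_k, v_k] = 2 x_{k+1}
  v_{k+2}. First type coefficients only supply letters below k - 1; the letter x_{k-1} is supplied
  by the second type element x_{k-1} v_k.\<close>

lemma second_type_lie_R:
  assumes two: "(2 :: 'k::field) \<noteq> 0" and "2 \<le> n" "A \<subseteq> tail_set n"
  shows "lmult (gmono A * gen (n - 1) :: 'k grassmann) * pivot n \<in> lie_R"
proof -
  \<comment> \<open>Here 2 has to be inverted.\<close>
  have halve: "lmult (a * gen (k + 1)) * pivot (k + 2) \<in> lie_R"
    if "lmult a * anticommutator (pivot k) (pivot k) \<in> lie_R" for a :: "'k grassmann" and k
  proof -
    have "anticommutator (pivot k) (pivot k) = escale 2 (mul_x (k + 1) * pivot (k + 2) :: 'k gend)"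
      unfolding anticommutator_def pivot_square using End.scale_left_distrib[of 1 1 "mul_x (k + 1) * pivot (k + 2) :: 'k gend"] by simp
    with that have "escale 2 (lmult (a * gen (k + 1)) * pivot (k + 2)) \<in> lie_R"
      by (simp add: escale_mult_right lmult_mult mul_x_def mult.assoc)
    with two show ?thesis by (simp add: lie_R_escale_iff)
  qed
  have low: "lmult (gmono B * gen (k + 1) :: 'k grassmann) * pivot (k + 2) \<in> lie_R"
    if "B \<subseteq> {..<k - 1}" for B k
  proof (rule halve)
    have "lmult (1 * gmono B :: 'k grassmann) * anticommutator (pivot k) (pivot k) \<in> lie_R"
    proof (rule lie_R_anticommutator)
      show "(1 :: 'k grassmann) \<in> gdeg 0" using gmono_gdeg[of "{}", where 'a = 'k] by simp
      show "lmult (1 :: 'k grassmann) * pivot k \<in> lie_R" using first_type_lie_R[of "{}" k, where 'k = 'k] by simp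
      show "app (pivot k) (gmono B :: 'k grassmann) = 0"
        using that by (intro pivot_supported_below supported_gmono) auto
      show "(gmono B :: 'k grassmann) \<in> gdeg (card B)" by (rule gmono_gdeg)
    qed (use that in \<open>simp_all add: first_type_lie_R\<close>)
    then show "lmult (gmono B :: 'k grassmann) * anticommutator (pivot k) (pivot k) \<in> lie_R" by simp
  qed
  define k where "k = n - 2"
  have k: "n = k + 2" "A \<subseteq> {i. i < k \<and> k \<noteq> 1}" using assms(2,3) by (auto simp: k_def tail_set_def)
  show ?thesis
  proof (cases "k - 1 \<in> A")
    case False
    then have "A \<subseteq> {..<k - 1}" using k(2) by (auto simp: subset_iff) (metis less_antisym Suc_pred gr_implies_not0 neq0_conv)
    then show ?thesis using low[of A k] k(1) by simp
  next
    case True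
    let ?B = "A - {k - 1}"
    \<comment> \<open>For k = 0 there are no letters, and k = 1 is excluded by
      \<open>tail_set\<close>: x_0 x_2 v_3 would call for x_0 v_1, which is not a standard
      monomial.\<close>
    have k2: "2 \<le> k" using True k(2) by auto
    have B: "?B \<subseteq> {..<k - 1}" using k(2) by fastforce
    then have "gmono (insert (k - 1) ?B) = gmono ?B * (gen (k - 1) :: 'k grassmann)"
      by (intro gmono_insert_greatest finite_subset[of ?B "{..<k - 1}"]) auto
    then have A: "gmono A = gmono ?B * (gen (k - 1) :: 'k grassmann)"
      using True by (simp add: insert_absorb)
    have "k - 2 + 1 = k - 1" "k - 2 + 2 = k" using k2 by auto
    then have "lmult (gen (k - 1) :: 'k grassmann) * pivot k \<in> lie_R" using low[of "{}" "k - 2"] by simp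
    then have "lmult (gmono A :: 'k grassmann) * anticommutator (pivot k) (pivot k) \<in> lie_R"
      unfolding A using B k2
      by (intro lie_R_anticommutator[OF gmono_gdeg _ _ gen_gdeg] pivot_supported_below supported_gmono
          supported_gen first_type_lie_R) auto
    from halve[OF this] show ?thesis by (simp add: k(1))
  qed
qed

lemma span_standard_basis:
  assumes two: "(2 :: 'k::field) \<noteq> 0"
  shows "End.span (standard_basis :: 'k gend set) = lie_R"
proof (rule antisym[OF _ lie_R_subset_span], rule End.span_minimal[OF _ lie_R_subspace])
  show "(standard_basis :: 'k gend set) \<subseteq> lie_R"
  proof
    fix T :: "'k gend" assume "T \<in> standard_basis"
    then obtain A n where "T = lmult (gmono A) * pivot n" and "A \<in> admissible n"
      by (auto simp: standard_basis_def)
    from this(2) show "T \<in> lie_R"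
    proof (cases rule: admissible_cases[where 'k = 'k])
      case first
      then show ?thesis using \<open>T = _\<close> first_type_lie_R by blast
    next
      case (second A')
      then show ?thesis using \<open>T = _\<close> second_type_lie_R[OF two second(1,2)] by simp
    qed
  qed
qed


section \<open>Linear independence\<close>

lemma lmult_pivot_gen:
  assumes "N \<le> n"
  shows "app (lmult a * pivot n) (gen N) = (if n = N then a else 0)"
  using assms by (auto simp: pivot_gen_self pivot_supported_below supported_gen)

lemma gmono_neq_zero: "finite A \<Longrightarrow> gmono A \<noteq> 0"
  by (metis coeff_zero gmono.rep_eq zero_neq_one)

lemma gmono_pivot_le:
  assumes "lmult a * pivot n = (lmult (gmono B) * pivot m :: 'k::field gend)" "finite B"
  shows "n \<le> m"
proof (rule ccontr)
  assume "\<not> n \<le> m"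
  then have "app (lmult a * pivot n) (gen m :: 'k grassmann) = 0" by (subst lmult_pivot_gen) auto
  moreover have "app (lmult (gmono B) * pivot m) (gen m :: 'k grassmann) = gmono B" by (subst lmult_pivot_gen) auto
  ultimately show False using assms gmono_neq_zero by metis
qed

text \<open>The basis is a set of operators, so deleting x_0 x_2 v_3 deletes exactly one pair of
  letter set and head only because distinct pairs give distinct operators.\<close>

lemma gmono_pivot_inject:
  assumes eq: "lmult (gmono A) * pivot n = (lmult (gmono B) * pivot m :: 'k::field gend)" and "finite A" "finite B"
  shows "A = B \<and> n = m"
proof -
  have nm: "n = m" using gmono_pivot_le[OF eq assms(3)] gmono_pivot_le[OF eq[symmetric] assms(2)] by simp
  have "app (lmult (gmono A) * pivot n) (gen n :: 'k grassmann) = app (lmult (gmono B) * pivot m) (gen n)"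
    by (simp only: eq)
  then have "(gmono A :: 'k grassmann) = gmono B" using nm by (simp add: pivot_gen_self)
  then have "coeff (gmono A :: 'k grassmann) A = coeff (gmono B) A" by simp
  then have "A = B" using assms(2) by (simp add: gmono.rep_eq split: if_splits)
  with nm show ?thesis by simp
qed

lemma independent_standard_basis: "End.independent (standard_basis :: 'k::field gend set)"
proof
  let ?\<phi> = "\<lambda>A n. lmult (gmono A) * pivot n :: 'k gend"
  assume "End.dependent (standard_basis :: 'k gend set)"
  then obtain S u v where S: "finite S" "S \<subseteq> standard_basis" and v: "v \<in> S" "u v \<noteq> 0"
    and sum: "(\<Sum>T\<in>S. escale (u T) T) = (0 :: 'k gend)"
    unfolding End.dependent_explicit by blast
  let ?P = "\<lambda>n. \<exists>A. A \<in> admissible n \<and> ?\<phi> A n \<in> S \<and> u (?\<phi> A n) \<noteq> 0"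
  \<comment> \<open>The least head that occurs with a nonzero coefficient.\<close>
  define N where "N = (LEAST n. ?P n)"
  have "v \<in> standard_basis" using v(1) S(2) by blast
  then obtain B n where "v = ?\<phi> B n" "B \<in> admissible n" unfolding standard_basis_def by blast
  then have "?P n" using v by blast
  then have "\<exists>n. ?P n" ..
  then have "?P N" unfolding N_def by (rule LeastI_ex)
  then obtain A where A: "A \<in> admissible N" "?\<phi> A N \<in> S" "u (?\<phi> A N) \<noteq> 0" by blast
  have fin: "finite B" if "B \<in> admissible n" for B n
    using admissible_lessThan[OF that] finite_subset by blast
  \<comment> \<open>By minimality a remaining term with nonzero coefficient has head v_N or higher.
    Higher heads vanish at x_N, and with head v_N the value is a monomial other than the one at
    A.\<close>
  have zero: "u T * coeff (app T (gen N)) A = 0" if T: "T \<in> S - {?\<phi> A N}" for T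
  proof (cases "u T = 0")
    case False
    obtain B n where B: "T = ?\<phi> B n" "B \<in> admissible n" using T S(2) by (auto simp: standard_basis_def)
    then have "?P n" using T False by auto
    then have "N \<le> n" unfolding N_def by (rule Least_le)
    moreover have "B \<noteq> A" if "n = N" using that T B(1) by auto
    ultimately show ?thesis unfolding B(1) lmult_pivot_gen[OF \<open>N \<le> n\<close>] by (auto simp: gmono.rep_eq)
  qed simp
  have rest: "(\<Sum>T\<in>S - {?\<phi> A N}. u T * coeff (app T (gen N)) A) = 0"
    by (rule sum.neutral, rule ballI, rule zero)
  have appsum: "app (sum h S) a = (\<Sum>T\<in>S. app (h T) a)" for h :: "'k gend \<Rightarrow> 'k gend" and a
    using S(1) by (induction S rule: finite_induct) auto
  have "0 = coeff (app (\<Sum>T\<in>S. escale (u T) T) (gen N)) A" by (simp add: sum)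
  also have "\<dots> = (\<Sum>T\<in>S. u T * coeff (app T (gen N)) A)" by (simp add: appsum coeff_sum)
  also have "\<dots> = u (?\<phi> A N) * coeff (app (?\<phi> A N) (gen N)) A"
    unfolding sum.remove[OF S(1) A(2)] rest by simp
  also have "\<dots> = u (?\<phi> A N)" using fin[OF A(1)] by (simp add: pivot_gen_self gmono.rep_eq)
  finally show False using A(3) by simp
qed

section \<open>Identification with tail monomials and the two standard families\<close>

lemma tail_monomial_gmono:
  assumes "\<forall>i. \<xi> i \<in> {0, 1}"
  shows "prod_list (map (\<lambda>i. mul_x (nat i) ^ \<xi> (nat i)) [0..int k - 1]) = (lmult (gmono {i. i < k \<and> \<xi> i = 1}) :: 'k::field gend)"
proof (induction k)
  case 0 then show ?case by simp
next
  case (Suc k)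
  let ?f = "\<lambda>i. mul_x (nat i) ^ \<xi> (nat i) :: 'k gend" and ?A = "{i. i < k \<and> \<xi> i = 1}"
  have "int (Suc k) - 1 = int k" by simp
  then have "[0..int (Suc k) - 1] = [0..int k - 1] @ [int k]" by (simp only: upto_rec2 of_nat_0_le_iff)
  then have step: "prod_list (map ?f [0..int (Suc k) - 1]) = lmult (gmono ?A) * mul_x k ^ \<xi> k"
    by (simp only: map_append prod_list.append Suc list.map prod_list.Cons prod_list.Nil nat_int mult_1_right)
  show ?case
  proof (cases "\<xi> k = 0")
    case True
    then have "{i. i < Suc k \<and> \<xi> i = 1} = ?A" by (auto simp: less_Suc_eq)
    then show ?thesis unfolding step using True by (simp only: power_0 mult_1_right)
  next
    case False
    then have 1: "\<xi> k = 1" using assms[rule_format, of k] by simp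
    then have "{i. i < Suc k \<and> \<xi> i = 1} = insert k ?A" by (auto simp: less_Suc_eq)
    \<comment> \<open>The list is increasing, so the new letter is the greatest and joins on the
      right without a sign.\<close>
    moreover have "gmono (insert k ?A) = gmono ?A * (gen k :: 'k grassmann)"
      by (rule gmono_insert_greatest) auto
    ultimately show ?thesis unfolding step using 1 by (simp only: power_one_right lmult_mult mul_x_def)
  qed
qed

lemma tail_monomials_eq: "tail_monomials m = {lmult (gmono A) :: 'k::field gend | A. A \<subseteq> {i. int i \<le> m}}"
proof -
  \<comment> \<open>The bound \<open>nat (m + 1)\<close> counts the available letters; it is 0 for
    every negative m, where the list is empty.\<close>
  have list: "[0..int (nat (m + 1)) - 1] = [0..m]" by (cases "0 \<le> m + 1") auto
  have lt: "i < nat (m + 1) \<longleftrightarrow> int i \<le> m" for i by auto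
  have eq: "prod_list (map (\<lambda>i. mul_x (nat i) ^ \<xi> (nat i)) [0..m]) = (lmult (gmono {i. int i \<le> m \<and> \<xi> i = 1}) :: 'k gend)"
    if "\<forall>i. \<xi> i \<in> {0, 1}" for \<xi>
    using tail_monomial_gmono[OF that, of "nat (m + 1)"] unfolding list lt .
  show ?thesis
  proof (intro equalityI subsetI)
    fix r :: "'k gend" assume "r \<in> tail_monomials m"
    then obtain \<xi> where \<xi>: "\<forall>i. \<xi> i \<in> {0, 1}"
      and r: "r = prod_list (map (\<lambda>i. mul_x (nat i) ^ \<xi> (nat i)) [0..m])"
      unfolding tail_monomials_def by blast
    have "r = lmult (gmono {i. int i \<le> m \<and> \<xi> i = 1})" unfolding r by (rule eq[OF \<xi>])
    then show "r \<in> {lmult (gmono A) | A. A \<subseteq> {i. int i \<le> m}}" by blast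
  next
    fix r :: "'k gend" assume "r \<in> {lmult (gmono A) | A. A \<subseteq> {i. int i \<le> m}}"
    then obtain A where A: "r = lmult (gmono A)" "A \<subseteq> {i. int i \<le> m}" by blast
    let ?\<xi> = "\<lambda>i. if i \<in> A then 1 else 0 :: nat"
    have \<xi>: "\<forall>i. ?\<xi> i \<in> {0, 1}" by simp
    have "A = {i. int i \<le> m \<and> ?\<xi> i = 1}" using A(2) by auto
    then have "r = prod_list (map (\<lambda>i. mul_x (nat i) ^ ?\<xi> (nat i)) [0..m])"
      using A(1) eq[OF \<xi>] by simp
    then show "r \<in> tail_monomials m" unfolding tail_monomials_def
      by (intro CollectI exI[of _ ?\<xi>]) simp
  qed
qed

lemma standard_monomials_1_eq:
  "standard_monomials_1 = {lmult (gmono A) * pivot n | A n. A \<subseteq> {..<n - 1}}"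
proof -
  have "{i. int i \<le> int n - 2} = {..<n - 1}" for n by auto
  then show ?thesis unfolding standard_monomials_1_def tail_monomials_eq by blast
qed

lemma standard_monomials_2_eq:
  "standard_monomials_2 =
    {lmult (gmono (insert (n - 1) A)) * pivot n | A n. 2 \<le> n \<and> A \<subseteq> {..<n - 2}}
    - {lmult (gmono {0, 2}) * pivot 3 :: 'k::field gend}"
proof -
  have eq: "{i. int i \<le> int n - 3} = {..<n - 2}" for n by auto
  have shift: "lmult (gmono A) * mul_x (n - 1) * pivot n = (lmult (gmono (insert (n - 1) A)) * pivot n :: 'k gend)"
    if "A \<subseteq> {..<n - 2}" for A n
  proof -
    have "gmono (insert (n - 1) A) = gmono A * (gen (n - 1) :: 'k grassmann)"
      using that by (intro gmono_insert_greatest finite_subset[OF that]) auto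
    then show ?thesis by (simp only: lmult_mult mul_x_def)
  qed
  have "{r * mul_x (n - 1) * pivot n | r n. 2 \<le> n \<and> r \<in> {lmult (gmono A) | A. A \<subseteq> {..<n - 2}}}
      = {lmult (gmono (insert (n - 1) A)) * pivot n :: 'k gend | A n. 2 \<le> n \<and> A \<subseteq> {..<n - 2}}"
    (is "?L = ?R")
  proof (intro equalityI subsetI)
    fix T assume "T \<in> ?L"
    then obtain A n where "T = lmult (gmono A) * mul_x (n - 1) * pivot n" "2 \<le> n" "A \<subseteq> {..<n - 2}" by blast
    with shift[of A n] show "T \<in> ?R" by auto
  next
    fix T assume "T \<in> ?R"
    then obtain A n where A: "T = lmult (gmono (insert (n - 1) A)) * pivot n" "2 \<le> n" "A \<subseteq> {..<n - 2}" by blast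
    then have "T = lmult (gmono A) * mul_x (n - 1) * pivot n" by (simp only: shift)
    with A(2,3) show "T \<in> ?L" by blast
  qed
  moreover have "mul_x 0 * mul_x 2 * pivot 3 = (lmult (gmono {0, 2}) * pivot 3 :: 'k gend)"
    using shift[of "{0}" 3] by (simp add: mul_x_def gen_def insert_commute)
  ultimately show ?thesis unfolding standard_monomials_2_def tail_monomials_eq eq by (simp only:)
qed

lemma standard_monomials_eq: "standard_monomials_1 \<union> standard_monomials_2 = (standard_basis :: 'k::field gend set)"
proof (intro equalityI subsetI)
  fix T :: "'k gend" assume "T \<in> standard_monomials_1 \<union> standard_monomials_2"
  then consider A n where "T = lmult (gmono A) * pivot n" "A \<subseteq> {..<n - 1}"
    | A n where "T = lmult (gmono (insert (n - 1) A)) * pivot n" "2 \<le> n" "A \<subseteq> {..<n - 2}"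
        "T \<noteq> lmult (gmono {0, 2}) * pivot 3"
    unfolding standard_monomials_1_eq standard_monomials_2_eq by blast
  then show "T \<in> standard_basis"
  proof cases
    case 1
    then show ?thesis by (auto simp: standard_basis_def admissible_def)
  next
    case (2 A n)
    \<comment> \<open>For n = 3 the only possible further letter is x_0, which gives precisely the
      deleted monomial.\<close>
    have "A = {}" if "n = 3"
    proof (rule ccontr)
      assume "A \<noteq> {}"
      then have "A = {0}" using 2(3) that by auto
      with 2(1,4) that show False by (simp add: insert_commute)
    qed
    then have "A \<subseteq> tail_set n" using 2(3) by (cases "n = 3") (auto simp: tail_set_def)
    then have "insert (n - 1) A \<in> admissible n" using 2(2) by (auto simp: admissible_def)
    then show ?thesis unfolding standard_basis_def 2(1) by blast
  qed
next
  fix T :: "'k gend" assume "T \<in> standard_basis"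
  then obtain A n where T: "T = lmult (gmono A) * pivot n" and A: "A \<in> admissible n"
    by (auto simp: standard_basis_def)
  show "T \<in> standard_monomials_1 \<union> standard_monomials_2"
  proof (cases "A \<subseteq> {..<n - 1}")
    case True
    then show ?thesis using T by (auto simp: standard_monomials_1_eq)
  next
    case False
    then have B: "2 \<le> n" "n - 1 \<in> A" "A - {n - 1} \<subseteq> tail_set n" using A by (auto simp: admissible_def)
    have "A \<noteq> {0, 2} \<or> n \<noteq> 3" using B(3) by (auto simp: tail_set_def)
    then have "T \<noteq> lmult (gmono {0, 2}) * pivot 3"
      using gmono_pivot_inject[of A n "{0, 2}" 3, where 'k = 'k] finite_subset[OF admissible_lessThan[OF A]] T by auto
    moreover have "A - {n - 1} \<subseteq> {..<n - 2}" using B(3) by (auto simp: tail_set_def)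
    moreover have "T = lmult (gmono (insert (n - 1) (A - {n - 1}))) * pivot n"
      using T B(2) by (simp add: insert_absorb)
    ultimately show ?thesis unfolding standard_monomials_2_eq using B(1) by blast
  qed
qed

theorem theorem5p1:
  assumes "CHAR('k::field) \<noteq> 2"
  shows "End.independent (standard_monomials_1 \<union> standard_monomials_2 :: 'k gend set)
    \<and> End.span (standard_monomials_1 \<union> standard_monomials_2 :: 'k gend set) = lie_R"
proof -
  have "(2 :: 'k) \<noteq> 0"
  proof
    assume "(2 :: 'k) = 0"
    then have "CHAR('k) dvd 2" using of_nat_eq_0_iff_char_dvd[of 2, where 'a = 'k] by simp
    moreover from this have "CHAR('k) \<noteq> 0" by (metis dvd_0_left_iff zero_neq_numeral)
    ultimately have "CHAR('k) \<le> 2" "CHAR('k) \<noteq> 0" by (auto intro: dvd_imp_le)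
    moreover have "CHAR('k) \<noteq> 1" by simp
    ultimately show False using assms by linarith
  qed
  then show ?thesis
    by (simp add: standard_monomials_eq independent_standard_basis span_standard_basis)
qed

end
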